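(* Let $M$ be a Riemannian manifold, $U\subseteq M$ a compact subset, and $f:U\to\operatorname{int}(U)$ a $C^1$ embedding. Then there is a subset $\Gamma$ of $U$ with full volume in $U$ such that, for every $x\in\Gamma$ and every empirical measure $\nu_x$ of $x$, $$\limsup_{n\to\infty}\frac1n\log|\det Df^n(x)|\le 0\quad\text{and}\quad \int_U\log|\det Df|\,d\nu_x\le 0 .$$
   Context: "Volume" is the Riemannian volume; $\Gamma\subseteq U$ has full volume in $U$ if $U\setminus\Gamma$ has zero volume. $\operatorname{int}(U)$ is the interior of $U$ in $M$. A $C^1$ embedding of $U$ means an injective map that is the restriction to $U$ of a $C^1$ local diffeomorphism defined on a neighborhood of $U$. $|\det Df|$ denotes the Jacobian with respect to the Riemannian volume. An empirical measure of $x\in U$ is any weak$^*$ accumulation point of the sequence of probability measures $\frac1n\sum_{i=0}^{n-1}\delta_{f^i(x)}$, $n\ge1$. *)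

theory Defs
  imports "HOL-Analysis.Analysis"
begin

text \<open>
  The underlying set of the manifold is a whole type \<open>'a\<close>, Hausdorff and second countable by its
  type class. A chart is its open domain together with a map that matters only on that domain.
\<close>

type_synonym ('a, 'n) chart = "'a set \<times> ('a \<Rightarrow> real ^ 'n)"

definition is_chart :: "('a::topological_space, 'n::finite) chart \<Rightarrow> bool" where
  "is_chart c \<longleftrightarrow> open (fst c) \<and> open (snd c ` fst c) \<and>
     homeomorphism (fst c) (snd c ` fst c) (snd c) (inv_into (fst c) (snd c))"

definition chart_inv :: "('a, 'n) chart \<Rightarrow> real ^ 'n \<Rightarrow> 'a" where
  "chart_inv c = inv_into (fst c) (snd c)"

definition local_rep ::
  "('a, 'n) chart \<Rightarrow> ('a, 'n) chart \<Rightarrow> ('a \<Rightarrow> 'a) \<Rightarrow> real ^ 'n \<Rightarrow> real ^ 'n" where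
  "local_rep c d f = snd d \<circ> f \<circ> chart_inv c"

text \<open>\<open>Ck_on k S f\<close> says that \<open>f\<close> is \<open>k\<close> times continuously differentiable, for open \<open>S\<close>.\<close>

primrec Ck_on ::
  "nat \<Rightarrow> 'e::euclidean_space set \<Rightarrow> ('e \<Rightarrow> 'b::euclidean_space) \<Rightarrow> bool" where
  "Ck_on 0 S f \<longleftrightarrow> continuous_on S f"
| "Ck_on (Suc k) S f \<longleftrightarrow> (\<forall>x\<in>S. f differentiable (at x)) \<and>
     (\<forall>v. Ck_on k S (\<lambda>x. frechet_derivative f (at x) v))"

definition smooth_on :: "'e::euclidean_space set \<Rightarrow> ('e \<Rightarrow> 'b::euclidean_space) \<Rightarrow> bool" where
  "smooth_on S f \<longleftrightarrow> (\<forall>k. Ck_on k S f)"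

text \<open>The atlas need not be maximal.\<close>

definition smooth_atlas :: "('a::topological_space, 'n::finite) chart set \<Rightarrow> bool" where
  "smooth_atlas A \<longleftrightarrow> (\<forall>c\<in>A. is_chart c) \<and> (\<Union>c\<in>A. fst c) = UNIV \<and>
     (\<forall>c\<in>A. \<forall>d\<in>A. smooth_on (snd c ` (fst c \<inter> fst d)) (local_rep c d id))"

text \<open>
  A Riemannian metric is given by its coordinate expressions: \<open>g c p v w\<close> is the inner product
  of the tangent vectors at \<open>p\<close> with coordinates \<open>v\<close> and \<open>w\<close> in the chart \<open>c\<close>. The last clause is
  the transformation law of a covariant 2-tensor.
\<close>

type_synonym ('a, 'n) metric =
  "('a, 'n) chart \<Rightarrow> 'a \<Rightarrow> real ^ 'n \<Rightarrow> real ^ 'n \<Rightarrow> real"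

definition riemannian_metric ::
  "('a::topological_space, 'n::finite) chart set \<Rightarrow> ('a, 'n) metric \<Rightarrow> bool" where
  "riemannian_metric A g \<longleftrightarrow>
     (\<forall>c\<in>A. \<forall>p\<in>fst c. bilinear (g c p) \<and> (\<forall>v w. g c p v w = g c p w v) \<and>
        (\<forall>v. v \<noteq> 0 \<longrightarrow> g c p v v > 0)) \<and>
     (\<forall>c\<in>A. \<forall>v w. smooth_on (snd c ` fst c) (\<lambda>y. g c (chart_inv c y) v w)) \<and>
     (\<forall>c\<in>A. \<forall>d\<in>A. \<forall>p\<in>fst c \<inter> fst d. \<forall>v w.
        g c p v w =
          (let T = frechet_derivative (local_rep c d id) (at (snd c p)) in g d p (T v) (T w)))"

definition riemannian_manifold ::
  "('a::{second_countable_topology,t2_space}, 'n::finite) chart set \<Rightarrow> ('a, 'n) metric \<Rightarrow> bool" where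
  "riemannian_manifold A g \<longleftrightarrow> smooth_atlas A \<and> riemannian_metric A g"

text \<open>The density of the Riemannian volume with respect to Lebesgue measure in a chart.\<close>

definition vol_density :: "('a, 'n::finite) metric \<Rightarrow> ('a, 'n) chart \<Rightarrow> 'a \<Rightarrow> real" where
  "vol_density g c p = sqrt (det ((\<chi> i j. g c p (axis i 1) (axis j 1)) :: real ^ 'n ^ 'n))"

text \<open>
  The Riemannian volume is assembled from a countable family of charts covering the manifold,
  each chart measuring what the previous ones have not covered. By the change of variables
  formula and the transformation law of \<open>g\<close>, it does not depend on the chosen family.
\<close>

definition chart_cover ::
  "('a, 'n) chart set \<Rightarrow> nat \<Rightarrow> ('a, 'n) chart" where
  "chart_cover A = (SOME c. range c \<subseteq> A \<and> (\<Union>n. fst (c n)) = UNIV)"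

definition chart_piece :: "('a, 'n) chart set \<Rightarrow> nat \<Rightarrow> 'a set" where
  "chart_piece A n = fst (chart_cover A n) - (\<Union>k<n. fst (chart_cover A k))"

definition riemannian_volume ::
  "('a::topological_space, 'n::finite) chart set \<Rightarrow> ('a, 'n) metric \<Rightarrow> 'a measure" where
  "riemannian_volume A g = measure_of UNIV (sets borel)
     (\<lambda>B. \<Sum>n. let c = chart_cover A n in
        \<integral>\<^sup>+ y \<in> snd c ` (B \<inter> chart_piece A n). ennreal (vol_density g c (chart_inv c y)) \<partial>lborel)"

text \<open>The formula defining \<open>riemannian_volume\<close> is countably additive, so \<open>measure_of\<close> returns it.\<close>

lemma chart_cover:
  fixes A :: "('a::{second_countable_topology,t2_space}, 'n::finite) chart set"
  assumes "smooth_atlas A"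
  shows "chart_cover A n \<in> A" "(\<Union>n. fst (chart_cover A n)) = UNIV"
proof -
  have "open (fst c)" if "c \<in> A" for c
    using assms that by (auto simp: smooth_atlas_def is_chart_def)
  then obtain F where F: "F \<subseteq> fst ` A" "countable F" "\<Union>F = \<Union>(fst ` A)"
    using Lindelof[of "fst ` A"] by (metis imageE)
  have U: "\<Union>F = UNIV" using F assms by (auto simp: smooth_atlas_def)
  obtain C where C: "C \<subseteq> A" "countable C" "F = fst ` C"
    using F countable_image_eq by (metis countable_subset_image)
  have "C \<noteq> {}" using U C by auto
  then have "range (from_nat_into C) \<subseteq> A \<and> (\<Union>n. fst (from_nat_into C n)) = UNIV"
    using C U range_from_nat_into[of C] by (metis image_image)
  then have "range (chart_cover A) \<subseteq> A \<and> (\<Union>n. fst (chart_cover A n)) = UNIV"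
    unfolding chart_cover_def
    by (rule someI[where P = "\<lambda>c. range c \<subseteq> A \<and> (\<Union>n. fst (c n)) = UNIV"])
  then show "chart_cover A n \<in> A" "(\<Union>n. fst (chart_cover A n)) = UNIV" by auto
qed

lemma continuous_on_vol_density:
  fixes A :: "('a::{second_countable_topology,t2_space}, 'n::finite) chart set"
  assumes "riemannian_manifold A g" "c \<in> A"
  shows "continuous_on (snd c ` fst c) (\<lambda>y. vol_density g c (chart_inv c y))"
proof -
  have "continuous_on (snd c ` fst c) (\<lambda>y. g c (chart_inv c y) v w)" for v w
    using assms unfolding riemannian_manifold_def riemannian_metric_def smooth_on_def
    by (metis Ck_on.simps(1))
  then show ?thesis unfolding vol_density_def det_def by (simp) (intro continuous_intros)
qed

lemma emeasure_riemannian_volume: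
  fixes A :: "('a::{second_countable_topology,t2_space}, 'n::finite) chart set"
  assumes M: "riemannian_manifold A g" and B: "B \<in> sets borel"
  shows "emeasure (riemannian_volume A g) B = (\<Sum>n. let c = chart_cover A n in
        \<integral>\<^sup>+ y \<in> snd c ` (B \<inter> chart_piece A n). ennreal (vol_density g c (chart_inv c y)) \<partial>lborel)"
proof -
  define h where "h n y = ennreal (vol_density g (chart_cover A n) (chart_inv (chart_cover A n) y))" for n y
  define I where "I n B = snd (chart_cover A n) ` (B \<inter> chart_piece A n)" for n B
  have at: "smooth_atlas A" using M by (simp add: riemannian_manifold_def)
  note cA = chart_cover[OF at]
  have ch: "is_chart (chart_cover A n)" for n using at cA by (auto simp: smooth_atlas_def)
  have pc: "chart_piece A n \<subseteq> fst (chart_cover A n)" for n by (auto simp: chart_piece_def)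
  have pB: "chart_piece A n \<in> sets borel" for n
    unfolding chart_piece_def using ch by (intro sets.Diff sets.finite_UN) (auto simp: is_chart_def)
  have IB: "I n B \<in> sets borel" if "B \<in> sets borel" for n B
  proof -
    let ?c = "chart_cover A n" and ?S = "snd (chart_cover A n) ` fst (chart_cover A n)"
    have hm: "homeomorphism (fst ?c) ?S (snd ?c) (chart_inv ?c)" and o: "open ?S"
      using ch[of n] by (auto simp: is_chart_def chart_inv_def)
    have "I n B = {y \<in> ?S. chart_inv ?c y \<in> B \<inter> chart_piece A n}"
      using hm pc[of n] unfolding I_def homeomorphism_def by force
    also have "\<dots> = chart_inv ?c -` (B \<inter> chart_piece A n) \<inter> space (restrict_space borel ?S)"
      by (auto simp: space_restrict_space)
    also have "\<dots> \<in> sets (restrict_space borel ?S)"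
      using hm pB that by (intro measurable_sets[of _ _ borel] borel_measurable_continuous_on_restrict)
         (auto simp: homeomorphism_def)
    finally show ?thesis using o by (auto simp: sets_restrict_space)
  qed
  have hI: "(\<lambda>y. h n y * indicator (I n B) y) \<in> borel_measurable borel" if "B \<in> sets borel" for n B
  proof -
    let ?c = "chart_cover A n" and ?S = "snd (chart_cover A n) ` fst (chart_cover A n)"
    have o: "?S \<in> sets borel" using ch[of n] by (auto simp: is_chart_def)
    have "(\<lambda>y. indicator ?S y *\<^sub>R vol_density g ?c (chart_inv ?c y)) \<in> borel_measurable borel"
      using borel_measurable_continuous_on_indicator[OF o continuous_on_vol_density[OF M cA(1)]] .
    then have "(\<lambda>y. ennreal (indicator ?S y *\<^sub>R vol_density g ?c (chart_inv ?c y)) * indicator (I n B) y)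
      \<in> borel_measurable borel" using IB[OF that, of n] by measurable
    moreover have "(\<lambda>y. ennreal (indicator ?S y *\<^sub>R vol_density g ?c (chart_inv ?c y)) * indicator (I n B) y)
       = (\<lambda>y. h n y * indicator (I n B) y)"
      using pc[of n] by (force simp: h_def I_def indicator_def fun_eq_iff)
    ultimately show ?thesis by simp
  qed
  define \<mu> where "\<mu> B = (\<Sum>n. \<integral>\<^sup>+ y. h n y * indicator (I n B) y \<partial>lborel)" for B
  have ca: "countably_additive (sets borel) \<mu>"
  proof (rule countably_additiveI)
    fix B :: "nat \<Rightarrow> 'a set" assume B: "range B \<subseteq> sets borel" "disjoint_family B"
    have inj: "inj_on (snd (chart_cover A n)) (fst (chart_cover A n))" for n
      using ch[of n] by (auto simp: is_chart_def homeomorphism_def intro: inj_on_inverseI)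
    have ind: "indicator (I n (\<Union>(range B))) y = (\<Sum>i. indicator (I n (B i)) y :: ennreal)" for n y
    proof -
      have "disjoint_family (\<lambda>i. I n (B i))"
        using inj[of n] pc[of n] B(2) unfolding disjoint_family_on_def I_def inj_on_def by blast
      moreover have "I n (\<Union>(range B)) = (\<Union>i. I n (B i))" by (auto simp: I_def)
      ultimately show ?thesis using suminf_indicator[of "\<lambda>i. I n (B i)" y] by simp
    qed
    have "(\<integral>\<^sup>+ y. h n y * indicator (I n (\<Union>(range B))) y \<partial>lborel)
       = (\<Sum>i. \<integral>\<^sup>+ y. h n y * indicator (I n (B i)) y \<partial>lborel)" for n
      unfolding ind ennreal_suminf_cmult[symmetric]
      by (rule nn_integral_suminf) (use hI B in auto)
    then have "\<mu> (\<Union>(range B)) = (\<Sum>n. \<Sum>i. \<integral>\<^sup>+ y. h n y * indicator (I n (B i)) y \<partial>lborel)"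
      by (simp add: \<mu>_def)
    also have "\<dots> = (\<Sum>i. \<mu> (B i))"
      unfolding \<mu>_def nn_integral_count_space_nat[symmetric]
      by (rule pair_sigma_finite.Fubini')
         (auto simp: pair_sigma_finite_def sigma_finite_measure_count_space_countable pair_measure_countable)
    finally show "(\<Sum>i. \<mu> (B i)) = \<mu> (\<Union>(range B))" by simp
  qed
  have eq: "riemannian_volume A g = measure_of UNIV (sets borel) \<mu>"
    unfolding riemannian_volume_def \<mu>_def h_def I_def by (simp add: Let_def)
  have "emeasure (riemannian_volume A g) B = \<mu> B"
    by (rule emeasure_measure_of[OF eq])
       (use ca B in \<open>auto simp: positive_def \<mu>_def I_def eq sets.sigma_sets_eq[of borel, simplified]\<close>)
  then show ?thesis by (simp add: \<mu>_def h_def I_def Let_def)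
qed

text \<open>
  The Jacobian \<open>|det Df(p)|\<close> with respect to the Riemannian volume. Its value does not depend on
  the chosen charts.
\<close>

definition chart_at :: "('a, 'n) chart set \<Rightarrow> 'a \<Rightarrow> ('a, 'n) chart" where
  "chart_at A p = (SOME c. c \<in> A \<and> p \<in> fst c)"

definition chart_jacobian ::
  "('a, 'n::finite) metric \<Rightarrow> ('a, 'n) chart \<Rightarrow> ('a, 'n) chart \<Rightarrow> ('a \<Rightarrow> 'a) \<Rightarrow> 'a \<Rightarrow> real" where
  "chart_jacobian g c d f p =
     \<bar>det (jacobian (local_rep c d f) (at (snd c p)))\<bar> * vol_density g d (f p) / vol_density g c p"

definition riemannian_jacobian ::
  "('a, 'n::finite) chart set \<Rightarrow> ('a, 'n) metric \<Rightarrow> ('a \<Rightarrow> 'a) \<Rightarrow> 'a \<Rightarrow> real" where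
  "riemannian_jacobian A g f p = chart_jacobian g (chart_at A p) (chart_at A (f p)) f p"

text \<open>In the following two definitions \<open>W\<close> and \<open>V\<close> are meant to be open.\<close>

definition C1_map_on ::
  "('a::topological_space, 'n::finite) chart set \<Rightarrow> 'a set \<Rightarrow> ('a \<Rightarrow> 'a) \<Rightarrow> bool" where
  "C1_map_on A W f \<longleftrightarrow> continuous_on W f \<and>
     (\<forall>c\<in>A. \<forall>d\<in>A. Ck_on 1 (snd c ` (W \<inter> fst c \<inter> f -` fst d)) (local_rep c d f))"

definition C1_local_diffeo_on ::
  "('a::topological_space, 'n::finite) chart set \<Rightarrow> 'a set \<Rightarrow> ('a \<Rightarrow> 'a) \<Rightarrow> bool" where
  "C1_local_diffeo_on A V f \<longleftrightarrow>
     (\<forall>x\<in>V. \<exists>W. open W \<and> x \<in> W \<and> W \<subseteq> V \<and> open (f ` W) \<and> C1_map_on A W f \<and>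
        (\<exists>h. C1_map_on A (f ` W) h \<and> (\<forall>y\<in>W. h (f y) = y)))"

text \<open>
  The total function \<open>f\<close> stands for the embedding of \<open>U\<close> together with its local diffeomorphic
  extension to a neighbourhood of \<open>U\<close>. The derivative of the embedding at points of \<open>U\<close> that are
  not interior is the derivative of this extension.
\<close>

definition C1_embedding ::
  "('a::topological_space, 'n::finite) chart set \<Rightarrow> 'a set \<Rightarrow> ('a \<Rightarrow> 'a) \<Rightarrow> bool" where
  "C1_embedding A U f \<longleftrightarrow> inj_on f U \<and> (\<exists>V. open V \<and> U \<subseteq> V \<and> C1_local_diffeo_on A V f)"

definition prob_measures_on :: "'a::topological_space set \<Rightarrow> 'a measure set" where
  "prob_measures_on U = {\<mu>. sets \<mu> = sets (restrict_space borel U) \<and> emeasure \<mu> U = 1}"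

text \<open>The weak* topology on the Borel probability measures of a compact set \<open>U\<close>.\<close>

definition weak_star_topology :: "'a::topological_space set \<Rightarrow> 'a measure topology" where
  "weak_star_topology U = topology_generated_by
     {{\<mu> \<in> prob_measures_on U. (\<integral>y. \<phi> y \<partial>\<mu>) \<in> S} | (\<phi> :: 'a \<Rightarrow> real) S.
        continuous_on U \<phi> \<and> open S}"

definition orbit_average ::
  "'a::topological_space set \<Rightarrow> ('a \<Rightarrow> 'a) \<Rightarrow> 'a \<Rightarrow> nat \<Rightarrow> 'a measure" where
  "orbit_average U f x n =
     distr (uniform_count_measure {..<n}) (restrict_space borel U) (\<lambda>i. (f ^^ i) x)"

definition empirical_measure ::
  "'a::topological_space set \<Rightarrow> ('a \<Rightarrow> 'a) \<Rightarrow> 'a \<Rightarrow> 'a measure \<Rightarrow> bool" where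
  "empirical_measure U f x \<nu> \<longleftrightarrow> \<nu> \<in> prob_measures_on U \<and>
     (\<forall>W. openin (weak_star_topology U) W \<and> \<nu> \<in> W \<longrightarrow>
        (\<exists>\<^sub>F n in sequentially. orbit_average U f x n \<in> W))"

end

theory Submission
  imports Defs "HOL-Combinatorics.Permutations"
begin

text \<open>
  Write \<open>J\<^sub>n\<close> for the Jacobian of \<open>f\<^sup>n\<close>. Since \<open>f\<^sup>n\<close> is injective on \<open>U\<close> and maps \<open>U\<close> into itself, the
  change of variables formula bounds the integral of \<open>J\<^sub>n\<close> over \<open>U\<close> by the finite volume of \<open>U\<close>, so
  \<open>J\<^sub>n \<ge> exp (n \<epsilon>)\<close> holds on a set of volume at most \<open>exp (- n \<epsilon>) vol U\<close>. By Borel-Cantelli almost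
  every \<open>x\<close> lies in only finitely many of these sets, for every \<open>\<epsilon> = 1 / (k + 1)\<close>, which is the claim
  on the limit superior. By the chain rule \<open>ln J\<^sub>n x / n\<close> is the integral of the continuous function
  \<open>ln J\<^sub>1\<close> against the \<open>n\<close>-th orbit average of \<open>x\<close>, so weak* accumulation points inherit the bound.
\<close>

section \<open>Change of variables in coordinates\<close>

text \<open>
  The change of variables theorem of HOL-Analysis needs a well-ordered index type; relabelling the
  coordinates by \<open>wo_index\<close> extends it to an arbitrary finite one.
\<close>

typedef ('n::finite) wo_index = "{..<CARD('n)}"
  by (auto intro: exI[of _ 0])

instantiation wo_index :: (finite) wellorder
begin

definition less_eq_wo_index :: "'a wo_index \<Rightarrow> 'a wo_index \<Rightarrow> bool" where
  "less_eq_wo_index x y \<longleftrightarrow> Rep_wo_index x \<le> Rep_wo_index y"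

definition less_wo_index :: "'a wo_index \<Rightarrow> 'a wo_index \<Rightarrow> bool" where
  "less_wo_index x y \<longleftrightarrow> Rep_wo_index x < Rep_wo_index y"

instance
proof
  fix P :: "'a wo_index \<Rightarrow> bool" and a
  assume "\<And>x. (\<And>y. y < x \<Longrightarrow> P y) \<Longrightarrow> P x"
  then show "P a"
    by (rule measure_induct_rule[of Rep_wo_index]) (simp add: less_wo_index_def)
qed (auto simp: less_eq_wo_index_def less_wo_index_def Rep_wo_index_inject)

end


section \<open>Relabelling the coordinates of determinants and of Lebesgue measure\<close>

lemma bij_betw_Rep_wo_index: "bij_betw (Rep_wo_index :: 'n::finite wo_index \<Rightarrow> nat) UNIV {..<CARD('n)}"
  by (metis type_definition.Rep_range type_definition_wo_index bij_betw_imageI injI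
      Rep_wo_index_inject)

instance wo_index :: (finite) finite
  by standard (use bij_betw_Rep_wo_index bij_betw_finite in blast)

lemma ex_bij_wo_index: "\<exists>b :: 'n::finite wo_index \<Rightarrow> 'n. bij b"
proof -
  obtain h :: "nat \<Rightarrow> 'n" where "bij_betw h {..<CARD('n)} UNIV"
    by (metis ex_bij_betw_nat_finite finite atLeast0LessThan)
  then show ?thesis
    using bij_betw_trans[OF bij_betw_Rep_wo_index] by blast
qed

text \<open>Conjugation by \<open>b\<close>, in the proof \<open>?m\<close>, is a sign-preserving
  bijection between the permutations of the two index types, and it matches the terms of the two
  Leibniz sums.\<close>

lemma det_reindex:
  fixes A :: "'a::comm_ring_1^'n^'n" and b :: "'m::finite \<Rightarrow> 'n"
  assumes b: "bij b"
  shows "det (\<chi> i j. A $ b i $ b j) = det A"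
proof -
  let ?m = "map_permutation UNIV b" and ?m' = "map_permutation UNIV (inv b)"
  have inj: "inj b" "inj (inv b)" using b by (auto simp: bij_is_inj bij_imp_bij_inv)
  have "bij_betw ?m {p. p permutes UNIV} {p. p permutes UNIV}"
  proof (rule bij_betw_byWitness[where f' = ?m'])
    show "\<forall>p\<in>{p. p permutes UNIV}. ?m' (?m p) = p"
      using b inj by (auto intro!: map_permutation_compose_inv simp: bij_imp_bij_inv)
    show "\<forall>p\<in>{p. p permutes UNIV}. ?m (?m' p) = p"
      using b inj by (auto intro!: map_permutation_compose_inv simp: bij_imp_bij_inv bij_is_surj surj_f_inv_f)
    show "?m ` {p. p permutes UNIV} \<subseteq> {p. p permutes UNIV}"
      using b by (auto intro: map_permutation_permutes)
    show "?m' ` {p. p permutes UNIV} \<subseteq> {p. p permutes UNIV}"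
      using b by (auto intro: map_permutation_permutes bij_imp_bij_inv)
  qed
  moreover have "of_int (sign (?m p)) * (\<Prod>i\<in>UNIV. A $ i $ ?m p i)
      = of_int (sign p) * (\<Prod>i\<in>UNIV. A $ b i $ b (p i))" if "p permutes UNIV" for p
  proof -
    have "(\<Prod>i\<in>UNIV. A $ i $ ?m p i) = (\<Prod>i\<in>UNIV. A $ b i $ ?m p (b i))"
      by (rule prod.reindex_bij_betw[OF b, symmetric])
    then show ?thesis
      using inj that by (simp add: map_permutation_apply sign_map_permutation)
  qed
  ultimately show ?thesis
    unfolding det_def by (subst sum.reindex_bij_betw[symmetric]) auto
qed

text \<open>Lebesgue measure is determined by its values on boxes, and the preimage of a box is a
  box with the same side lengths in another order.\<close>

lemma lborel_reindex:
  fixes b :: "'m::finite \<Rightarrow> 'n::finite"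
  assumes b: "bij b"
  shows "distr lborel borel (\<lambda>x::real^'n. (\<chi> i. x $ b i) :: real^'m) = lborel"
proof (rule lborel_eqI[symmetric])
  fix l u :: "real^'m"
  assume le: "\<And>k. k \<in> Basis \<Longrightarrow> l \<bullet> k \<le> u \<bullet> k"
  let ?L = "\<lambda>x::real^'n. (\<chi> i. x $ b i) :: real^'m" and ?R = "\<lambda>x::real^'m. (\<chi> j. x $ inv b j) :: real^'n"
  have Bas: "(Basis :: (real^'k::finite) set) = range (\<lambda>i. axis i 1)" by (auto simp: Basis_vec_def)
  have le': "l $ i \<le> u $ i" for i
    using le[of "axis i 1"] by (simp add: axis_in_Basis_iff inner_axis)
  have bi: "b (inv b j) = j" "inv b (b i) = i" for i j
    using b by (auto simp: bij_is_surj surj_f_inv_f bij_is_inj)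
  have [measurable]: "?L \<in> borel \<rightarrow>\<^sub>M borel"
    by (intro borel_measurable_continuous_onI continuous_intros)
  have "?L -` box l u = box (?R l) (?R u)"
    by (auto simp: mem_box_cart) (metis bi)+
  then have "emeasure (distr lborel borel ?L) (box l u) = emeasure lborel (box (?R l) (?R u))"
    by (simp add: emeasure_distr)
  also have "\<dots> = ennreal (\<Prod>j\<in>Basis. (?R u - ?R l) \<bullet> j)"
    using le' by (intro emeasure_lborel_box) (auto simp: Basis_vec_def inner_axis)
  also have "(\<Prod>j\<in>Basis. (?R u - ?R l) \<bullet> j) = (\<Prod>j\<in>UNIV. (u - l) $ inv b j)"
    by (simp add: Bas prod.reindex inner_axis inj_on_def axis_eq_axis)
  also have "\<dots> = (\<Prod>i\<in>UNIV. (u - l) $ i)"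
    using prod.reindex_bij_betw[OF bij_imp_bij_inv[OF b]] by fastforce
  also have "\<dots> = (\<Prod>k\<in>Basis. (u - l) \<bullet> k)"
    by (simp add: Bas prod.reindex inner_axis inj_on_def axis_eq_axis)
  finally show "emeasure (distr lborel borel ?L) (box l u) = (\<Prod>k\<in>Basis. (u - l) \<bullet> k)" .
qed simp

text \<open>An inequality suffices for the volume estimate. The pointwise lower bound
  \<open>u\<close> stands in for the transformed integrand, so that later only a constant multiple
  of a density has to be integrated.\<close>

lemma nn_integral_image_ge_wellorder:
  fixes \<phi> :: "real^'m::{finite,wellorder} \<Rightarrow> real^'m::_" and u w :: "real^'m::_ \<Rightarrow> real"
  assumes S: "S \<in> sets borel" and w: "set_borel_measurable borel (\<phi> ` S) w"
    and nonneg: "\<And>y. y \<in> \<phi> ` S \<Longrightarrow> 0 \<le> w y"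
    and der: "\<And>x. x \<in> S \<Longrightarrow> (\<phi> has_derivative \<phi>' x) (at x within S)"
    and inj: "inj_on \<phi> S"
    and u: "\<And>x. x \<in> S \<Longrightarrow> u x \<le> \<bar>det (matrix (\<phi>' x))\<bar> * w (\<phi> x)"
  shows "(\<integral>\<^sup>+x\<in>S. ennreal (u x) \<partial>lborel) \<le> (\<integral>\<^sup>+y\<in>\<phi> ` S. ennreal (w y) \<partial>lborel)"
\<comment> \<open>An infinite right-hand side leaves nothing to prove. A finite one makes
  \<open>w\<close> integrable over the image, which is the input of the change of variables
  theorem.\<close>
proof (cases "(\<integral>\<^sup>+y\<in>\<phi> ` S. ennreal (w y) \<partial>lborel) < \<infinity>")
  case True
  let ?g = "\<lambda>x. \<bar>det (matrix (\<phi>' x))\<bar> * w (\<phi> x)"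
  note eq = set_nn_integral_lborel_eq_integral[OF w nonneg True]
  have "(\<integral>\<^sup>+y. ennreal (norm (indicator (\<phi> ` S) y *\<^sub>R w y)) \<partial>lborel) = (\<integral>\<^sup>+y\<in>\<phi> ` S. ennreal (w y) \<partial>lborel)"
    using nonneg by (intro nn_integral_cong) (auto simp: indicator_def)
  then have "set_integrable lborel (\<phi> ` S) w"
    using w True by (auto simp: set_integrable_def integrable_iff_bounded set_borel_measurable_def)
  \<comment> \<open>Absolute integrability refers to the completion of \<open>lborel\<close>, so
    integrability is carried over to it.\<close>
  then have int: "w absolutely_integrable_on \<phi> ` S"
    unfolding set_integrable_def by (rule integrable_completion[THEN iffD2, rotated])
      (use w in \<open>auto simp: set_borel_measurable_def\<close>)
  \<comment> \<open>The change of variables theorem concerns vector-valued integrands;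
    \<open>w\<close> enters through \<open>vec\<close> as a map into \<open>real^1\<close>.\<close>
  have g: "?g absolutely_integrable_on S" "integral S ?g = integral (\<phi> ` S) w"
    using has_absolute_integral_change_of_variables[of S \<phi> \<phi>' "\<lambda>y. vec (w y) :: real^1" "vec (integral (\<phi> ` S) w)"]
      S der inj int
    by (auto simp: absolutely_integrable_on_1_iff integral_on_1_eq vec_eq_iff)
  have "(?g has_integral integral (\<phi> ` S) w) S"
    using g absolutely_integrable_on_def has_integral_iff by blast
  then have "(\<integral>\<^sup>+x. ennreal (?g x) * indicator S x \<partial>lborel) = ennreal (integral (\<phi> ` S) w)"
    by (intro nn_integral_has_integral_lebesgue') (use nonneg in auto)
  moreover have "(\<integral>\<^sup>+x\<in>S. ennreal (u x) \<partial>lborel) \<le> (\<integral>\<^sup>+x. ennreal (?g x) * indicator S x \<partial>lborel)"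
    using u by (intro nn_integral_mono) (auto simp: indicator_def intro!: ennreal_leI)
  ultimately show ?thesis using eq by simp
qed (simp add: not_less top_unique)

text \<open>Conjugates \<open>\<phi>\<close> by the linear relabelling \<open>L\<close> with inverse
  \<open>R\<close>, which preserves Lebesgue measure. The left integral is transported as well,
  whence the measurability of \<open>u\<close>.\<close>

lemma nn_integral_image_ge:
  fixes \<phi> :: "real^'n::finite \<Rightarrow> real^'n" and u w :: "real^'n \<Rightarrow> real"
  assumes S: "S \<in> sets borel" and w: "set_borel_measurable borel (\<phi> ` S) w"
    and nonneg: "\<And>y. y \<in> \<phi> ` S \<Longrightarrow> 0 \<le> w y"
    and der: "\<And>x. x \<in> S \<Longrightarrow> (\<phi> has_derivative \<phi>' x) (at x within S)"
    and inj: "inj_on \<phi> S"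
    and u: "\<And>x. x \<in> S \<Longrightarrow> u x \<le> \<bar>det (matrix (\<phi>' x))\<bar> * w (\<phi> x)"
    and meas: "set_borel_measurable borel S u"
  shows "(\<integral>\<^sup>+x\<in>S. ennreal (u x) \<partial>lborel) \<le> (\<integral>\<^sup>+y\<in>\<phi> ` S. ennreal (w y) \<partial>lborel)"
proof -
  obtain b :: "'n wo_index \<Rightarrow> 'n" where b: "bij b" using ex_bij_wo_index by blast
  have bi: "b (inv b j) = j" "inv b (b i) = i" for i j
    using b by (auto simp: bij_is_surj surj_f_inv_f bij_is_inj)
  define L where "L = (\<lambda>x::real^'n. (\<chi> i. x $ b i) :: real^('n wo_index))"
  define R where "R = (\<lambda>x::real^('n wo_index). (\<chi> j. x $ inv b j) :: real^'n)"
  have LR: "L (R y) = y" "R (L x) = x" for x y by (simp_all add: L_def R_def bi vec_eq_iff)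
  have linL: "linear L" and linR: "linear R" by (auto simp: L_def R_def linear_iff vec_eq_iff)
  have [measurable]: "L \<in> borel \<rightarrow>\<^sub>M borel" "R \<in> borel \<rightarrow>\<^sub>M borel"
    using linL linR by (auto intro!: borel_measurable_continuous_onI linear_continuous_on linear_conv_bounded_linear[THEN iffD1])
  have tr: "(\<integral>\<^sup>+x\<in>T. ennreal (v x) \<partial>lborel) = (\<integral>\<^sup>+y\<in>L ` T. ennreal (v (R y)) \<partial>lborel)"
    if "set_borel_measurable borel T v" for T v
  proof -
    have lb: "(lborel :: (real^'n) measure) = distr lborel borel R"
      using lborel_reindex[OF bij_imp_bij_inv[OF b]] unfolding R_def by simp
    have eq: "(\<lambda>x. ennreal (v x) * indicator T x) = (\<lambda>x. ennreal (indicator T x *\<^sub>R v x))"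
      by (auto simp: indicator_def)
    have ind: "indicator T (R y) = (indicator (L ` T) y :: ennreal)" for y
      unfolding indicator_def by (auto simp: image_iff LR)
    have "(\<integral>\<^sup>+x\<in>T. ennreal (v x) \<partial>lborel) = (\<integral>\<^sup>+y. ennreal (v (R y)) * indicator T (R y) \<partial>lborel)"
      by (subst lb, subst nn_integral_distr)
         (use that in \<open>auto simp: eq set_borel_measurable_def\<close>)
    then show ?thesis by (simp add: ind)
  qed
  have imL: "L ` T = R -` T" for T by (auto simp: image_iff LR) (metis LR(1))
  have "(\<integral>\<^sup>+y\<in>L ` S. ennreal (u (R y)) \<partial>lborel)
      \<le> (\<integral>\<^sup>+y\<in>(L \<circ> \<phi> \<circ> R) ` L ` S. ennreal (w (R y)) \<partial>lborel)"
  proof (rule nn_integral_image_ge_wellorder[where \<phi>' = "\<lambda>y. L \<circ> \<phi>' (R y) \<circ> R"])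
    show "L ` S \<in> sets borel"
      using measurable_sets[of R borel borel S] S by (simp add: imL)
    have im: "(L \<circ> \<phi> \<circ> R) ` L ` S = L ` \<phi> ` S" by (simp add: image_image LR)
    have "(\<lambda>y. indicator (\<phi> ` S) (R y) *\<^sub>R w (R y)) \<in> borel_measurable borel"
      using w unfolding set_borel_measurable_def by measurable
    then show "set_borel_measurable borel ((L \<circ> \<phi> \<circ> R) ` L ` S) (\<lambda>y. w (R y))"
      unfolding set_borel_measurable_def im unfolding imL by (simp add: indicator_def)
    show "0 \<le> w (R y)" if "y \<in> (L \<circ> \<phi> \<circ> R) ` L ` S" for y
      using that nonneg by (auto simp: LR)
    show "inj_on (L \<circ> \<phi> \<circ> R) (L ` S)"
      using inj by (auto simp: inj_on_def LR) (metis LR(2))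
    show "((L \<circ> \<phi> \<circ> R) has_derivative L \<circ> \<phi>' (R y) \<circ> R) (at y within L ` S)" if "y \<in> L ` S" for y
    proof -
      have "R ` L ` S = S" by (simp add: image_image LR)
      moreover have "(R has_derivative R) (at y within L ` S)" "(L has_derivative L) F" for F
        using linL linR by (auto intro: linear_imp_has_derivative)
      ultimately show ?thesis
        using that der[of "R y"]
        by (intro diff_chain_within[of R] diff_chain_within[of "\<phi>"]) (auto simp: o_assoc[symmetric] LR)
    qed
    show "u (R y) \<le> \<bar>det (matrix (L \<circ> \<phi>' (R y) \<circ> R))\<bar> * w (R ((L \<circ> \<phi> \<circ> R) y))" if "y \<in> L ` S" for y
    proof -
      \<comment> \<open>Conjugating the derivative relabels rows and columns of its matrix alike,
        which leaves the determinant unchanged.\<close>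
      have "matrix (L \<circ> f \<circ> R) = (\<chi> i j. matrix f $ b i $ b j)" for f
      proof -
        have "R (axis i 1) = axis (b i) 1" for i by (auto simp: R_def axis_def vec_eq_iff bi)
        then show ?thesis by (simp add: matrix_def L_def)
      qed
      then show ?thesis using that u by (auto simp: LR det_reindex[OF b])
    qed
  qed
  then show ?thesis using tr[OF w] tr[OF meas] by (simp add: image_image LR)
qed

section \<open>Jacobians on a Riemannian manifold\<close>

lemma det_pos_of_positive_definite:
  fixes G :: "real^'n^'n"
  assumes pos: "\<And>v. v \<noteq> 0 \<Longrightarrow> v \<bullet> (G *v v) > 0"
  shows "det G > 0"
proof (rule ccontr)
  assume *: "\<not> det G > 0"
  \<comment> \<open>Every matrix on the segment from the identity to \<open>G\<close> is positive
    definite, hence nonsingular, so the determinant cannot pass from 1 to a nonpositive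
    value.\<close>
  define H where "H t = (1 - t) *\<^sub>R mat 1 + t *\<^sub>R G" for t :: real
  have "continuous_on {0..1} (\<lambda>t. det (H t))"
    unfolding H_def det_def by (simp) (intro continuous_intros)
  moreover have "det (H 0) \<ge> 0" "det (H 1) \<le> 0" using * by (auto simp: H_def)
  ultimately obtain t where t: "0 \<le> t" "t \<le> 1" "det (H t) = 0"
    using IVT2'[of "\<lambda>t. det (H t)" 1 0 0] by auto
  then obtain v where v: "v \<noteq> 0" "H t *v v = 0"
    using invertible_det_nz[of "H t"]
    unfolding invertible_left_inverse matrix_left_invertible_ker by auto
  have "v \<bullet> (H t *v v) = (1 - t) * (v \<bullet> v) + t * (v \<bullet> (G *v v))"
    by (simp add: H_def matrix_vector_mult_add_rdistrib scaleR_matrix_vector_assoc[symmetric] inner_add_right)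
  moreover have "(1 - t) * (v \<bullet> v) \<ge> 0" "t * (v \<bullet> (G *v v)) \<ge> 0" "v \<bullet> v > 0" "v \<bullet> (G *v v) > 0"
    using t v pos[of v] by auto
  \<comment> \<open>The two weights sum to 1, so they cannot both vanish.\<close>
  moreover have "(1 - t) * (v \<bullet> v) > 0 \<or> t * (v \<bullet> (G *v v)) > 0"
    using calculation(4,5) t by (cases "t = 0") auto
  ultimately have "v \<bullet> (H t *v v) > 0" by linarith
  then show False using v by simp
qed

lemma bilinear_eq_inner_gram:
  fixes B :: "real^'n::finite \<Rightarrow> real^'n \<Rightarrow> real"
  assumes "bilinear B"
  shows "B x y = x \<bullet> ((\<chi> i j. B (axis i 1) (axis j 1)) *v y)"
proof -
  have "B x y = B (\<Sum>i\<in>UNIV. x $ i *\<^sub>R axis i 1) (\<Sum>j\<in>UNIV. y $ j *\<^sub>R axis j 1)"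
    using basis_expansion[of x] basis_expansion[of y] by (simp add: scalar_mult_eq_scaleR)
  also have "\<dots> = (\<Sum>i\<in>UNIV. \<Sum>j\<in>UNIV. x $ i * (y $ j * B (axis i 1) (axis j 1)))"
    using assms by (simp add: bilinear_sum sum.cartesian_product bilinear_lmul bilinear_rmul)
  finally show ?thesis
    by (simp add: inner_vec_def matrix_vector_mult_def sum_distrib_left mult.commute mult.left_commute)
qed

section \<open>Differentiability and the chain rule in charts\<close>

locale riemannian =
  fixes A :: "('a::{second_countable_topology,t2_space}, 'n::finite) chart set"
    and g :: "('a, 'n) metric"
  assumes M: "riemannian_manifold A g"
begin

lemma chartD:
  assumes "c \<in> A"
  shows "open (fst c)" "open (snd c ` fst c)"
    "\<And>p. p \<in> fst c \<Longrightarrow> chart_inv c (snd c p) = p"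
    "\<And>y. y \<in> snd c ` fst c \<Longrightarrow> snd c (chart_inv c y) = y"
    "continuous_on (fst c) (snd c)" "continuous_on (snd c ` fst c) (chart_inv c)"
  using M assms
  by (auto simp: riemannian_manifold_def smooth_atlas_def is_chart_def homeomorphism_def chart_inv_def)

lemma ex_chart: "\<exists>c\<in>A. p \<in> fst c"
  using M by (auto simp: riemannian_manifold_def smooth_atlas_def)

lemma chart_at: "chart_at A p \<in> A" "p \<in> fst (chart_at A p)"
  using someI_ex[of "\<lambda>c. c \<in> A \<and> p \<in> fst c"] ex_chart[of p] unfolding chart_at_def by blast+

text \<open>Carries local properties from the manifold to coordinates, by continuity of the inverse
  chart.\<close>

lemma eventually_nhds_chart:
  assumes "c \<in> A" "p \<in> fst c" "eventually P (nhds p)"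
  shows "eventually (\<lambda>y. P (chart_inv c y)) (nhds (snd c p))"
proof -
  have "isCont (chart_inv c) (snd c p)"
    using chartD[OF assms(1)] assms(2) by (simp add: continuous_on_eq_continuous_at)
  then have "filterlim (chart_inv c) (nhds p) (nhds (snd c p))"
    using chartD(3)[OF assms(1,2)] by (simp add: isCont_def tendsto_nhds_iff)
  then show ?thesis
    using assms(3) by (simp add: filterlim_iff)
qed

text \<open>A chart map carries information only on its domain; continuity keeps the images of
  nearby points inside the chart domain around \<open>f p\<close>, so that \<open>local_rep\<close>
  is meaningful there. Quantifying over all pairs of charts lets charts be exchanged freely.\<close>

definition manifold_differentiable_at :: "('a \<Rightarrow> 'a) \<Rightarrow> 'a \<Rightarrow> bool" where
  "manifold_differentiable_at f p \<longleftrightarrow> isCont f p \<and>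
     (\<forall>c\<in>A. \<forall>d\<in>A. p \<in> fst c \<longrightarrow> f p \<in> fst d \<longrightarrow> local_rep c d f differentiable at (snd c p))"

lemma eventually_nhds_isCont:
  "isCont f p \<Longrightarrow> eventually P (nhds (f p)) \<Longrightarrow> eventually (\<lambda>y. P (f y)) (nhds p)"
  for f :: "'b::t2_space \<Rightarrow> 'c::topological_space"
  by (metis eventually_compose_filterlim isCont_def tendsto_at_iff_tendsto_nhds)

text \<open>Agreement of \<open>k\<close> with the composition is asked only near \<open>p\<close>,
  which admits \<open>k = id\<close> with \<open>h\<close> a local inverse of
  \<open>f\<close>.\<close>

lemma local_rep_comp:
  assumes f: "manifold_differentiable_at f p" and h: "manifold_differentiable_at h (f p)"
    and k: "eventually (\<lambda>y. k y = h (f y)) (nhds p)"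
    and c: "c \<in> A" "p \<in> fst c" and d: "d \<in> A" "f p \<in> fst d" and e: "e \<in> A" "k p \<in> fst e"
  shows "(local_rep c e k has_derivative
      frechet_derivative (local_rep d e h) (at (snd d (f p))) \<circ> frechet_derivative (local_rep c d f) (at (snd c p)))
      (at (snd c p))"
proof -
  have kp: "k p = h (f p)" by (rule eventually_nhds_x_imp_x[OF k])
  have "(local_rep c d f has_derivative frechet_derivative (local_rep c d f) (at (snd c p))) (at (snd c p))"
    using f c d by (simp add: manifold_differentiable_at_def frechet_derivative_works)
  moreover have cd: "local_rep c d f (snd c p) = snd d (f p)"
    using chartD(3)[OF c] by (simp add: local_rep_def)
  moreover have "(local_rep d e h has_derivative frechet_derivative (local_rep d e h) (at (snd d (f p)))) (at (snd d (f p)))"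
    using h d e by (simp add: manifold_differentiable_at_def frechet_derivative_works kp)
  ultimately have D: "(local_rep d e h \<circ> local_rep c d f has_derivative
      frechet_derivative (local_rep d e h) (at (snd d (f p))) \<circ> frechet_derivative (local_rep c d f) (at (snd c p)))
      (at (snd c p))"
    by (metis diff_chain_at)
  \<comment> \<open>Near \<open>p\<close> the values of \<open>f\<close> stay in the domain of
    \<open>d\<close>, where \<open>chart_inv d\<close> undoes \<open>snd d\<close>; hence the
    composed local representations agree with that of \<open>k\<close>.\<close>
  have "eventually (\<lambda>y. f y \<in> fst d) (nhds p)"
  proof (rule eventually_nhds_isCont[where P = "\<lambda>q. q \<in> fst d"])
    show "isCont f p" using f by (simp add: manifold_differentiable_at_def)
    show "eventually (\<lambda>q. q \<in> fst d) (nhds (f p))"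
      by (rule eventually_nhds_in_open[OF chartD(1)[OF d(1)] d(2)])
  qed
  with k have "eventually (\<lambda>y. k y = h (f y) \<and> f y \<in> fst d) (nhds p)"
    by (rule eventually_conj)
  then have "eventually (\<lambda>y. k (chart_inv c y) = h (f (chart_inv c y)) \<and> f (chart_inv c y) \<in> fst d) (nhds (snd c p))"
    by (rule eventually_nhds_chart[OF c])
  then have "eventually (\<lambda>y. (local_rep d e h \<circ> local_rep c d f) y = local_rep c e k y) (nhds (snd c p))"
    by eventually_elim (simp add: local_rep_def chartD(3)[OF d(1)])
  then show ?thesis
    by (intro has_derivative_transform_eventually[OF D _ _ UNIV_I])
       (auto simp: eventually_at_filter elim: eventually_mono dest: eventually_nhds_x_imp_x)
qed

lemma manifold_differentiable_at_comp:
  assumes "manifold_differentiable_at f p" and "manifold_differentiable_at h (f p)"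
    and k: "eventually (\<lambda>y. k y = h (f y)) (nhds p)"
  shows "manifold_differentiable_at k p"
  unfolding manifold_differentiable_at_def
proof (intro conjI ballI impI)
  have "isCont f p" "isCont h (f p)"
    using assms(1,2) by (simp_all add: manifold_differentiable_at_def)
  then have "isCont (\<lambda>y. h (f y)) p" by (rule isCont_o2)
  then show "isCont k p" using isCont_cong[OF k] by blast
next
  fix c e assume ce: "c \<in> A" "e \<in> A" "p \<in> fst c" "k p \<in> fst e"
  obtain d where d: "d \<in> A" "f p \<in> fst d" using ex_chart by blast
  show "local_rep c e k differentiable at (snd c p)"
    using local_rep_comp[OF assms ce(1,3) d ce(2,4)] by (rule differentiableI)
qed

lemma det_jacobian_comp:
  assumes "manifold_differentiable_at f p" and "manifold_differentiable_at h (f p)"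
    and "eventually (\<lambda>y. k y = h (f y)) (nhds p)"
    and c: "c \<in> A" "p \<in> fst c" and d: "d \<in> A" "f p \<in> fst d" and e: "e \<in> A" "k p \<in> fst e"
  shows "det (jacobian (local_rep c e k) (at (snd c p))) =
    det (jacobian (local_rep d e h) (at (snd d (f p)))) * det (jacobian (local_rep c d f) (at (snd c p)))"
proof -
  have kp: "k p = h (f p)" by (rule eventually_nhds_x_imp_x[OF assms(3)])
  have "linear (frechet_derivative (local_rep d e h) (at (snd d (f p))))"
    "linear (frechet_derivative (local_rep c d f) (at (snd c p)))"
    using assms kp by (auto simp: manifold_differentiable_at_def intro!: linear_frechet_derivative)
  then show ?thesis
    using frechet_derivative_at[OF local_rep_comp[OF assms], symmetric]
    by (simp add: jacobian_def matrix_compose det_mul)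
qed

text \<open>The local representations of \<open>id\<close> are the transition maps, so a change of
  charts becomes an instance of the chain rule.\<close>

lemma manifold_differentiable_at_id: "manifold_differentiable_at id p"
  unfolding manifold_differentiable_at_def
proof (intro conjI ballI impI)
  fix c d assume "c \<in> A" "d \<in> A" "p \<in> fst c" "id p \<in> fst d"
  moreover have "Ck_on 1 (snd c ` (fst c \<inter> fst d)) (local_rep c d id)"
    using M calculation by (auto simp: riemannian_manifold_def smooth_atlas_def smooth_on_def simp del: Ck_on.simps)
  ultimately show "local_rep c d id differentiable at (snd c p)" by simp
qed (simp add: id_def)

section \<open>The metric and its volume density\<close>

lemma metricD:
  shows "c \<in> A \<Longrightarrow> p \<in> fst c \<Longrightarrow> bilinear (g c p)"
    and "c \<in> A \<Longrightarrow> p \<in> fst c \<Longrightarrow> v \<noteq> 0 \<Longrightarrow> g c p v v > 0"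
    and "c \<in> A \<Longrightarrow> p \<in> fst c \<Longrightarrow> d \<in> A \<Longrightarrow> p \<in> fst d \<Longrightarrow> g c p v w =
      g d p (frechet_derivative (local_rep c d id) (at (snd c p)) v)
        (frechet_derivative (local_rep c d id) (at (snd c p)) w)"
proof -
  have "(\<forall>c\<in>A. \<forall>p\<in>fst c. bilinear (g c p) \<and> (\<forall>v w. g c p v w = g c p w v) \<and>
        (\<forall>v. v \<noteq> 0 \<longrightarrow> g c p v v > 0)) \<and> (\<forall>c\<in>A. \<forall>d\<in>A. \<forall>p\<in>fst c \<inter> fst d. \<forall>v w.
        g c p v w =
          (let T = frechet_derivative (local_rep c d id) (at (snd c p)) in g d p (T v) (T w)))"
    using M unfolding riemannian_manifold_def riemannian_metric_def by (elim conjE) (intro conjI)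
  note D = this[THEN conjunct1, rule_format] this[THEN conjunct2, rule_format, unfolded Let_def]
  show "c \<in> A \<Longrightarrow> p \<in> fst c \<Longrightarrow> bilinear (g c p)"
    "c \<in> A \<Longrightarrow> p \<in> fst c \<Longrightarrow> v \<noteq> 0 \<Longrightarrow> g c p v v > 0"
    using D(1) by blast+
  show "c \<in> A \<Longrightarrow> p \<in> fst c \<Longrightarrow> d \<in> A \<Longrightarrow> p \<in> fst d \<Longrightarrow> g c p v w =
      g d p (frechet_derivative (local_rep c d id) (at (snd c p)) v)
        (frechet_derivative (local_rep c d id) (at (snd c p)) w)"
    by (rule D(2)) auto
qed

lemma gram_positive_definite:
  assumes "c \<in> A" "p \<in> fst c" "v \<noteq> 0"
  shows "v \<bullet> ((\<chi> i j. g c p (axis i 1) (axis j 1)) *v v) > 0"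
  using metricD(2)[OF assms] unfolding bilinear_eq_inner_gram[OF metricD(1)[OF assms(1,2)], of v v] .

lemma vol_density_pos: "c \<in> A \<Longrightarrow> p \<in> fst c \<Longrightarrow> vol_density g c p > 0"
  unfolding vol_density_def real_sqrt_gt_0_iff
  by (rule det_pos_of_positive_definite) (rule gram_positive_definite)

text \<open>With \<open>J\<close> the matrix of the transition map, the transformation law says
  \<open>G c = transpose J ** G d ** J\<close>; taking determinants and square roots gives the
  claim.\<close>

lemma vol_density_change_chart:
  assumes c: "c \<in> A" "p \<in> fst c" and d: "d \<in> A" "p \<in> fst d"
  shows "vol_density g c p = \<bar>det (jacobian (local_rep c d id) (at (snd c p)))\<bar> * vol_density g d p"
proof -
  define T where "T = frechet_derivative (local_rep c d id) (at (snd c p))"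
  define J where "J = matrix T"
  define G where "G c = (\<chi> i j. g c p (axis i 1) (axis j 1))" for c
  have "linear T"
    using manifold_differentiable_at_id assms unfolding T_def
    by (intro linear_frechet_derivative) (auto simp: manifold_differentiable_at_def)
  then have T: "T v = J *v v" for v by (simp add: J_def matrix_works)
  note bil = metricD(1)[OF c] metricD(1)[OF d]
  have "g c p v w = g d p (T v) (T w)" for v w
    unfolding T_def by (rule metricD(3)[OF c d])
  then have "v \<bullet> (G c *v w) = (J *v v) \<bullet> (G d *v (J *v w))" for v w
    using bilinear_eq_inner_gram[OF bil(1)] bilinear_eq_inner_gram[OF bil(2)] T by (metis G_def)
  then have "v \<bullet> (G c *v w) = v \<bullet> ((transpose J ** G d ** J) *v w)" for v w
    using dot_lmul_matrix[of v "transpose J"] transpose_matrix_vector[of "transpose J" v]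
    by (simp add: matrix_vector_mul_assoc[symmetric])
  then have "G c *v w = (transpose J ** G d ** J) *v w" for w
    by (rule vector_eq_ldot[THEN iffD1, OF allI])
  then have "G c = transpose J ** G d ** J" by (simp add: matrix_eq)
  then have "det (G c) = (det J)\<^sup>2 * det (G d)" by (simp add: det_mul power2_eq_square)
  then show ?thesis
    by (simp add: vol_density_def G_def real_sqrt_mult J_def T_def jacobian_def)
qed

section \<open>The Jacobian with respect to the Riemannian volume\<close>

lemma chart_jacobian_comp:
  assumes "manifold_differentiable_at f p" "manifold_differentiable_at h (f p)"
    "eventually (\<lambda>y. k y = h (f y)) (nhds p)"
    "c \<in> A" "p \<in> fst c" "d \<in> A" "f p \<in> fst d" "e \<in> A" "k p \<in> fst e"
  shows "chart_jacobian g c e k p = chart_jacobian g c d f p * chart_jacobian g d e h (f p)"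
proof -
  have "k p = h (f p)" by (rule eventually_nhds_x_imp_x[OF assms(3)])
  \<comment> \<open>The density at the intermediate point occurs once as a numerator and once as a
    denominator; being positive, it cancels.\<close>
  moreover have "vol_density g d (f p) > 0" using assms vol_density_pos by blast
  ultimately show ?thesis
    using det_jacobian_comp[OF assms] by (simp add: chart_jacobian_def abs_mult)
qed

lemma chart_jacobian_id:
  assumes "c \<in> A" "p \<in> fst c" "d \<in> A" "p \<in> fst d"
  shows "chart_jacobian g c d id p = 1"
  using vol_density_change_chart[OF assms, symmetric] vol_density_pos[OF assms(1,2)]
  by (simp add: chart_jacobian_def)

text \<open>Composing with \<open>id\<close> before and after \<open>f\<close> inserts a change of
  charts on either side, and each contributes the factor 1.\<close>

lemma riemannian_jacobian_eq_chart_jacobian: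
  assumes f: "manifold_differentiable_at f p" and c: "c \<in> A" "p \<in> fst c" and d: "d \<in> A" "f p \<in> fst d"
  shows "riemannian_jacobian A g f p = chart_jacobian g c d f p"
proof -
  let ?c = "chart_at A p" and ?d = "chart_at A (f p)"
  have id: "manifold_differentiable_at id q" for q by (rule manifold_differentiable_at_id)
  have "chart_jacobian g ?c ?d f p = chart_jacobian g ?c d f p * chart_jacobian g d ?d id (f p)"
    by (rule chart_jacobian_comp[of f p id f]) (simp_all add: f c d chart_at id)
  also have "chart_jacobian g ?c d f p = chart_jacobian g ?c c id p * chart_jacobian g c d f (id p)"
    by (rule chart_jacobian_comp[of id p f f]) (simp_all add: f c d chart_at id)
  finally show ?thesis
    by (simp only: riemannian_jacobian_def chart_jacobian_id[OF chart_at c] chart_jacobian_id[OF d chart_at]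
        id_apply[of p] mult_1_left mult_1_right)
qed

lemma riemannian_jacobian_comp:
  assumes "manifold_differentiable_at f p" "manifold_differentiable_at h (f p)"
    "eventually (\<lambda>y. k y = h (f y)) (nhds p)"
  shows "riemannian_jacobian A g k p = riemannian_jacobian A g f p * riemannian_jacobian A g h (f p)"
proof -
  have "k p = h (f p)" by (rule eventually_nhds_x_imp_x[OF assms(3)])
  then show ?thesis
    using chart_jacobian_comp[OF assms chart_at[of p] chart_at[of "f p"] chart_at[of "k p"]]
    by (simp only: riemannian_jacobian_def)
qed

lemma riemannian_jacobian_id: "riemannian_jacobian A g id p = 1"
  unfolding riemannian_jacobian_def id_apply[of p] by (rule chart_jacobian_id[OF chart_at chart_at])

lemma riemannian_jacobian_nonneg: "riemannian_jacobian A g f p \<ge> 0"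
  using vol_density_pos[OF chart_at[of p]] vol_density_pos[OF chart_at[of "f p"]]
  unfolding riemannian_jacobian_def chart_jacobian_def
  by (intro divide_nonneg_pos mult_nonneg_nonneg) auto

lemma manifold_differentiable_at_C1_map:
  assumes "C1_map_on A W f" "open W" "p \<in> W"
  shows "manifold_differentiable_at f p"
  unfolding manifold_differentiable_at_def
proof (intro conjI ballI impI)
  have "continuous_on W f" using assms(1) unfolding C1_map_on_def by blast
  then show "isCont f p" using assms(2,3) by (simp add: continuous_on_eq_continuous_at)
  fix c d assume *: "c \<in> A" "d \<in> A" "p \<in> fst c" "f p \<in> fst d"
  then have "Ck_on 1 (snd c ` (W \<inter> fst c \<inter> f -` fst d)) (local_rep c d f)"
    using assms(1) unfolding C1_map_on_def by blast
  moreover have "snd c p \<in> snd c ` (W \<inter> fst c \<inter> f -` fst d)" using * assms(3) by blast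
  ultimately show "local_rep c d f differentiable at (snd c p)"
    unfolding One_nat_def Ck_on.simps by blast
qed

text \<open>The chart picked by \<open>chart_at\<close> may jump with the point. Continuity is
  therefore read off from one fixed pair of charts on the neighbourhood \<open>N\<close>, where the
  Jacobian has the same value.\<close>

lemma isCont_riemannian_jacobian_C1_map:
  assumes f: "C1_map_on A W f" and W: "open W" "p \<in> W"
  shows "isCont (riemannian_jacobian A g f) p"
proof -
  obtain c where c: "c \<in> A" "p \<in> fst c" using ex_chart by blast
  obtain d where d: "d \<in> A" "f p \<in> fst d" using ex_chart by blast
  define N where "N = W \<inter> fst c \<inter> f -` fst d"
  have "continuous_on W f" using f by (simp add: C1_map_on_def)
  then have "open (W \<inter> f -` fst d)"
    using W(1) chartD(1)[OF d(1)] by (rule continuous_open_preimage)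
  moreover have "N = fst c \<inter> (W \<inter> f -` fst d)" by (auto simp: N_def)
  ultimately have N: "open N" "p \<in> N"
    using W c d chartD(1)[OF c(1)] by (auto simp: N_def)
  have dif: "manifold_differentiable_at f q" if "q \<in> N" for q
    using that manifold_differentiable_at_C1_map[OF f W(1)] by (auto simp: N_def)
  have C1: "Ck_on 1 (snd c ` N) (local_rep c d f)"
    using f c d unfolding C1_map_on_def N_def by blast
  have cN: "continuous_on N (snd c)" "continuous_on N f"
    using chartD(5)[OF c(1)] \<open>continuous_on W f\<close> by (auto simp: N_def intro: continuous_on_subset)
  have "continuous_on N (\<lambda>q. frechet_derivative (local_rep c d f) (at (snd c q)) v)" for v
    using C1 by (intro continuous_on_compose2[OF _ cN(1)]) auto
  then have 1: "continuous_on N (\<lambda>q. \<bar>det (jacobian (local_rep c d f) (at (snd c q)))\<bar>)"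
    unfolding jacobian_def matrix_def det_def by (simp) (intro continuous_intros)
  have dens: "continuous_on (fst e) (vol_density g e)" if e: "e \<in> A" for e
  proof -
    have "continuous_on (fst e) (\<lambda>q. vol_density g e (chart_inv e (snd e q)))"
      by (rule continuous_on_compose2[OF continuous_on_vol_density[OF M e] chartD(5)[OF e]]) auto
    then show ?thesis by (simp add: chartD(3)[OF e] cong: continuous_on_cong)
  qed
  have 2: "continuous_on N (\<lambda>q. vol_density g d (f q))"
    by (rule continuous_on_compose2[OF dens[OF d(1)] cN(2)]) (auto simp: N_def)
  have 3: "continuous_on N (vol_density g c)"
    using dens[OF c(1)] by (rule continuous_on_subset) (auto simp: N_def)
  have "continuous_on N (chart_jacobian g c d f)"
    unfolding chart_jacobian_def
    by (intro continuous_intros 1 2 3) (use vol_density_pos[OF c(1)] in \<open>force simp: N_def\<close>)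
  moreover have "riemannian_jacobian A g f q = chart_jacobian g c d f q" if "q \<in> N" for q
    using that c d by (intro riemannian_jacobian_eq_chart_jacobian dif) (auto simp: N_def)
  ultimately have "continuous_on N (riemannian_jacobian A g f)"
    by (simp cong: continuous_on_cong)
  then show ?thesis using N by (simp add: continuous_on_eq_continuous_at)
qed

lemma C1_local_diffeo:
  assumes f: "C1_local_diffeo_on A V f" and p: "p \<in> V"
  shows "manifold_differentiable_at f p" "isCont (riemannian_jacobian A g f) p"
    "riemannian_jacobian A g f p > 0"
proof -
  obtain W h where W: "open W" "p \<in> W" "open (f ` W)" "C1_map_on A W f"
    and h: "C1_map_on A (f ` W) h" "\<forall>y\<in>W. h (f y) = y"
    using f p unfolding C1_local_diffeo_on_def by metis
  show f: "manifold_differentiable_at f p" "isCont (riemannian_jacobian A g f) p"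
    using manifold_differentiable_at_C1_map isCont_riemannian_jacobian_C1_map W by auto
  have "manifold_differentiable_at h (f p)"
    using manifold_differentiable_at_C1_map[OF h(1) W(3)] W(2) by auto
  moreover have "eventually (\<lambda>y. id y = h (f y)) (nhds p)"
    using W(1,2) h(2) by (auto simp: eventually_nhds)
  \<comment> \<open>The local inverse \<open>h\<close> makes the Jacobian of \<open>f\<close> a
    factor of 1, so it cannot vanish.\<close>
  ultimately have "1 = riemannian_jacobian A g f p * riemannian_jacobian A g h (f p)"
    using riemannian_jacobian_comp[OF f(1)] riemannian_jacobian_id by metis
  then show "riemannian_jacobian A g f p > 0"
    using riemannian_jacobian_nonneg[of f p] by (cases "riemannian_jacobian A g f p = 0") auto
qed

lemma funpow_jacobian:
  assumes "\<And>i. i < n \<Longrightarrow> manifold_differentiable_at f ((f ^^ i) p)"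
  shows "manifold_differentiable_at (f ^^ n) p"
    "riemannian_jacobian A g (f ^^ n) p = (\<Prod>i<n. riemannian_jacobian A g f ((f ^^ i) p))"
proof -
  have "manifold_differentiable_at (f ^^ n) p \<and>
    riemannian_jacobian A g (f ^^ n) p = (\<Prod>i<n. riemannian_jacobian A g f ((f ^^ i) p))"
    using assms
  proof (induction n)
    case 0
    then show ?case using manifold_differentiable_at_id[of p] riemannian_jacobian_id[of p]
      by (simp add: id_def)
  next
    case (Suc n)
    then have "manifold_differentiable_at (f ^^ n) p" "manifold_differentiable_at f ((f ^^ n) p)" by auto
    note c = this always_eventually[of "\<lambda>y. (f ^^ Suc n) y = f ((f ^^ n) y)"]
    show ?case
      using manifold_differentiable_at_comp[OF c] riemannian_jacobian_comp[OF c] Suc by simp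
  qed
  then show "manifold_differentiable_at (f ^^ n) p"
    "riemannian_jacobian A g (f ^^ n) p = (\<Prod>i<n. riemannian_jacobian A g f ((f ^^ i) p))" by auto
qed

section \<open>Riemannian volume of images\<close>

lemma inj_on_chart: "c \<in> A \<Longrightarrow> inj_on (snd c) (fst c)"
  by (rule inj_on_inverseI[of _ "chart_inv c"]) (rule chartD(3))

text \<open>Measures with one chart only, without the pieces of the cover. It is meant for sets
  inside the chart domain, where it agrees with the Riemannian volume by
  \<open>emeasure_volume_chart\<close>.\<close>

definition chart_volume :: "('a, 'n) chart \<Rightarrow> 'a set \<Rightarrow> ennreal" where
  "chart_volume c B = (\<integral>\<^sup>+ y \<in> snd c ` B. ennreal (vol_density g c (chart_inv c y)) \<partial>lborel)"

text \<open>The image is a preimage under the inverse chart, which is continuous on an open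
  set.\<close>

lemma chart_image_borel:
  assumes c: "c \<in> A" and B: "B \<subseteq> fst c" "B \<in> sets borel"
  shows "snd c ` B \<in> sets borel"
proof -
  let ?S = "snd c ` fst c"
  have "snd c ` B = {y \<in> ?S. chart_inv c y \<in> B}"
    using chartD(3)[OF c] B(1) by force
  also have "\<dots> = chart_inv c -` B \<inter> space (restrict_space borel ?S)"
    by (auto simp: space_restrict_space)
  also have "\<dots> \<in> sets (restrict_space borel ?S)"
    by (rule measurable_sets[OF borel_measurable_continuous_on_restrict[OF chartD(6)[OF c]] B(2)])
  finally show ?thesis using chartD(2)[OF c] by (auto simp: sets_restrict_space)
qed

lemma set_borel_measurable_vol_density:
  assumes c: "c \<in> A" and B: "B \<subseteq> fst c" "B \<in> sets borel"
  shows "set_borel_measurable borel (snd c ` B) (\<lambda>y. vol_density g c (chart_inv c y))"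
proof -
  let ?S = "snd c ` fst c"
  have "set_borel_measurable borel ?S (\<lambda>y. vol_density g c (chart_inv c y))"
    unfolding set_borel_measurable_def
    by (rule borel_measurable_continuous_on_indicator[OF _ continuous_on_vol_density[OF M c]])
       (use chartD(2)[OF c] in simp)
  then show ?thesis
    by (rule set_borel_measurable_subset) (use chart_image_borel[OF assms] B in auto)
qed

text \<open>Change of variables with Markov's inequality built in: a constant lower bound
  \<open>t\<close> replaces the integral of the Jacobian. The integrands compared are
  \<open>t\<close> times the density in \<open>c\<close> and the density in
  \<open>d\<close>.\<close>

lemma chart_volume_image_ge:
  assumes c: "c \<in> A" "B \<subseteq> fst c" and d: "d \<in> A" "F ` B \<subseteq> fst d"
    and B: "B \<in> sets borel" "F ` B \<in> sets borel" and inj: "inj_on F B"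
    and dif: "\<And>p. p \<in> B \<Longrightarrow> manifold_differentiable_at F p"
    and t: "t \<ge> 0" "\<And>p. p \<in> B \<Longrightarrow> t \<le> riemannian_jacobian A g F p"
  shows "ennreal t * chart_volume c B \<le> chart_volume d (F ` B)"
proof -
  let ?S = "snd c ` B" and ?\<phi> = "local_rep c d F"
  let ?u = "\<lambda>y. vol_density g c (chart_inv c y)" and ?w = "\<lambda>y. vol_density g d (chart_inv d y)"
  have inv: "chart_inv c (snd c p) = p" if "p \<in> B" for p using chartD(3)[OF c(1)] c(2) that by auto
  have \<phi>: "?\<phi> (snd c p) = snd d (F p)" if "p \<in> B" for p
    using inv[OF that] by (simp add: local_rep_def)
  have im: "?\<phi> ` ?S = snd d ` F ` B" using \<phi> by force
  have der: "(?\<phi> has_derivative frechet_derivative ?\<phi> (at y)) (at y within ?S)" if y: "y \<in> ?S" for y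
  proof -
    obtain p where p: "p \<in> B" "y = snd c p" using y by blast
    then have "?\<phi> differentiable at y"
      using dif[OF p(1)] c d unfolding manifold_differentiable_at_def by blast
    then show ?thesis by (simp add: frechet_derivative_works has_derivative_at_withinI)
  qed
  have injd: "inj_on (snd d) (fst d)" by (rule inj_on_chart[OF d(1)])
  have "inj_on ?\<phi> ?S"
  proof (rule inj_onI)
    fix y z assume "y \<in> ?S" "z \<in> ?S" and eq: "?\<phi> y = ?\<phi> z"
    then obtain p q where pq: "p \<in> B" "y = snd c p" "q \<in> B" "z = snd c q" by blast
    then have "snd d (F p) = snd d (F q)" using eq \<phi> by simp
    then have "F p = F q" using injd pq d(2) by (auto dest: inj_onD)
    then show "y = z" using inj pq by (auto dest: inj_onD)
  qed
  \<comment> \<open>Up to the positive density in \<open>c\<close>, this is the bound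
    \<open>t \<le> chart_jacobian g c d F p\<close>.\<close>
  moreover have "t * ?u y \<le> \<bar>det (matrix (frechet_derivative ?\<phi> (at y)))\<bar> * ?w (?\<phi> y)" if y: "y \<in> ?S" for y
  proof -
    obtain p where p: "p \<in> B" "y = snd c p" using y by blast
    have pc: "p \<in> fst c" "F p \<in> fst d" using p c d by auto
    have "t \<le> chart_jacobian g c d F p"
      using t(2)[OF p(1)] riemannian_jacobian_eq_chart_jacobian[OF dif[OF p(1)] c(1) pc(1) d(1) pc(2)] by simp
    then show ?thesis
      using vol_density_pos[OF c(1) pc(1)] inv[OF p(1)] \<phi>[OF p(1)] chartD(3)[OF d(1) pc(2)]
      by (simp add: chart_jacobian_def p(2) jacobian_def pos_le_divide_eq)
  qed
  moreover have "0 \<le> ?w z" if z: "z \<in> ?\<phi> ` ?S" for z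
  proof -
    obtain q where q: "q \<in> fst d" "z = snd d q" using z d(2) unfolding im by blast
    then show ?thesis using vol_density_pos[OF d(1) q(1)] chartD(3)[OF d(1) q(1)] by simp
  qed
  moreover have mu: "set_borel_measurable borel ?S ?u"
    by (rule set_borel_measurable_vol_density) (use c B in auto)
  then have "set_borel_measurable borel ?S (\<lambda>y. t * ?u y)"
    using borel_measurable_times[of "\<lambda>_. t" borel "\<lambda>y. indicator ?S y *\<^sub>R ?u y"]
    unfolding set_borel_measurable_def by (simp add: mult.left_commute)
  moreover have "set_borel_measurable borel (?\<phi> ` ?S) ?w"
    unfolding im by (rule set_borel_measurable_vol_density) (use d B in auto)
  moreover have "?S \<in> sets borel" by (rule chart_image_borel) (use c B in auto)
  ultimately have "(\<integral>\<^sup>+y\<in>?S. ennreal (t * ?u y) \<partial>lborel) \<le> (\<integral>\<^sup>+y\<in>?\<phi> ` ?S. ennreal (?w y) \<partial>lborel)"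
    by (intro nn_integral_image_ge[where \<phi>' = "\<lambda>y. frechet_derivative ?\<phi> (at y)"] der) auto
  also have "(\<integral>\<^sup>+y\<in>?S. ennreal (t * ?u y) \<partial>lborel) = (\<integral>\<^sup>+y. ennreal t * (ennreal (?u y) * indicator ?S y) \<partial>lborel)"
    using t(1) by (simp add: ennreal_mult' mult.assoc)
  also have "\<dots> = ennreal t * (\<integral>\<^sup>+y\<in>?S. ennreal (?u y) \<partial>lborel)"
  proof (rule nn_integral_cmult)
    have "(\<lambda>y. ennreal (?u y) * indicator ?S y) = (\<lambda>y. ennreal (indicator ?S y *\<^sub>R ?u y))"
      by (auto simp: indicator_def)
    then show "(\<lambda>y. ennreal (?u y) * indicator ?S y) \<in> borel_measurable lborel"
      using mu unfolding set_borel_measurable_def by simp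
  qed
  finally show ?thesis unfolding chart_volume_def im .
qed

text \<open>The identity has Jacobian 1, so \<open>chart_volume_image_ge\<close> with
  \<open>t = 1\<close> gives both inequalities.\<close>

lemma chart_volume_change_chart:
  assumes c: "c \<in> A" "B \<subseteq> fst c" and d: "d \<in> A" "B \<subseteq> fst d" and B: "B \<in> sets borel"
  shows "chart_volume c B = chart_volume d B"
proof -
  have "chart_volume c B \<le> chart_volume d B"
    if "c \<in> A" "B \<subseteq> fst c" "d \<in> A" "B \<subseteq> fst d" for c d
    using chart_volume_image_ge[of c B d id 1] that B manifold_differentiable_at_id riemannian_jacobian_id
    by simp
  then show ?thesis using c d by (simp add: antisym)
qed

lemma chart_volume_UN:
  assumes c: "c \<in> A" and B: "\<And>i. B i \<subseteq> fst c" "\<And>i. B i \<in> sets borel" "disjoint_family B"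
  shows "chart_volume c (\<Union>i. B i) = (\<Sum>i. chart_volume c (B i))"
proof -
  let ?u = "\<lambda>y. vol_density g c (chart_inv c y)"
  have inj: "inj_on (snd c) (fst c)" by (rule inj_on_chart[OF c])
  have dis: "disjoint_family (\<lambda>i. snd c ` B i)"
    unfolding disjoint_family_on_def
  proof (intro ballI impI)
    fix i j :: nat assume "i \<noteq> j"
    then have "B i \<inter> B j = {}" using B(3) by (simp add: disjoint_family_on_def)
    then show "snd c ` B i \<inter> snd c ` B j = {}"
      using inj_on_image_Int[OF inj B(1) B(1), of i j] by simp
  qed
  have "chart_volume c (\<Union>i. B i) = (\<integral>\<^sup>+y. (\<Sum>i. ennreal (?u y) * indicator (snd c ` B i) y) \<partial>lborel)"
    unfolding chart_volume_def image_UN suminf_indicator[OF dis, symmetric] ennreal_suminf_cmult ..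
  also have "\<dots> = (\<Sum>i. chart_volume c (B i))"
    unfolding chart_volume_def
  proof (rule nn_integral_suminf)
    fix i
    have "(\<lambda>y. ennreal (?u y) * indicator (snd c ` B i) y) = (\<lambda>y. ennreal (indicator (snd c ` B i) y *\<^sub>R ?u y))"
      by (auto simp: indicator_def)
    then show "(\<lambda>y. ennreal (?u y) * indicator (snd c ` B i) y) \<in> borel_measurable lborel"
      using set_borel_measurable_vol_density[OF c B(1,2)] unfolding set_borel_measurable_def by simp
  qed
  finally show ?thesis .
qed

section \<open>Gluing the chart estimates together\<close>

lemma chart_piece:
  "disjoint_family (chart_piece A)" "(\<Union>n. chart_piece A n) = UNIV"
  "chart_piece A n \<in> sets borel" "chart_piece A n \<subseteq> fst (chart_cover A n)"
proof -
  have at: "smooth_atlas A" using M by (simp add: riemannian_manifold_def)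
  have eq: "chart_piece A = disjointed (\<lambda>n. fst (chart_cover A n))"
    by (auto simp: chart_piece_def disjointed_def fun_eq_iff)
  show "disjoint_family (chart_piece A)" unfolding eq by (rule disjoint_family_disjointed)
  show "(\<Union>n. chart_piece A n) = UNIV" unfolding eq UN_disjointed_eq by (rule chart_cover(2)[OF at])
  show "chart_piece A n \<in> sets borel"
    unfolding chart_piece_def using chartD(1)[OF chart_cover(1)[OF at]]
    by (intro sets.Diff sets.finite_UN) auto
  show "chart_piece A n \<subseteq> fst (chart_cover A n)" by (auto simp: chart_piece_def)
qed

lemma chart_cover_atlas: "chart_cover A n \<in> A"
  using M by (intro chart_cover) (simp add: riemannian_manifold_def)

text \<open>Each piece of \<open>B\<close> is measured in its own chart of the cover; all are moved
  to \<open>c\<close> by \<open>chart_volume_change_chart\<close> and reassembled by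
  additivity.\<close>

lemma emeasure_volume_chart:
  assumes c: "c \<in> A" and B: "B \<subseteq> fst c" "B \<in> sets borel"
  shows "emeasure (riemannian_volume A g) B = chart_volume c B"
proof -
  have BP: "B \<inter> chart_piece A n \<in> sets borel" for n using B(2) chart_piece(3) by auto
  have "emeasure (riemannian_volume A g) B = (\<Sum>n. chart_volume (chart_cover A n) (B \<inter> chart_piece A n))"
    unfolding emeasure_riemannian_volume[OF M B(2)] chart_volume_def by (simp add: Let_def)
  also have "\<dots> = (\<Sum>n. chart_volume c (B \<inter> chart_piece A n))"
    by (intro suminf_cong chart_volume_change_chart chart_cover_atlas c BP) (use B(1) chart_piece(4) in auto)
  also have "\<dots> = chart_volume c (\<Union>n. B \<inter> chart_piece A n)"
  proof (rule chart_volume_UN[symmetric, OF c])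
    show "disjoint_family (\<lambda>n. B \<inter> chart_piece A n)"
      using chart_piece(1) unfolding disjoint_family_on_def by blast
  qed (use B BP in auto)
  also have "(\<Union>n. B \<inter> chart_piece A n) = B" using chart_piece(2) by auto
  finally show ?thesis .
qed

lemma sets_riemannian_volume [measurable_cong, simp]: "sets (riemannian_volume A g) = sets borel"
  unfolding riemannian_volume_def using sets.sigma_sets_eq[of borel] by (simp add: sets_measure_of)

lemma space_riemannian_volume [simp]: "space (riemannian_volume A g) = UNIV"
  unfolding riemannian_volume_def by (simp add: space_measure_of_conv)

text \<open>The set is cut into countably many parts, each lying in one chart domain together with
  its image in another, where \<open>chart_volume_image_ge\<close> applies.\<close>

lemma emeasure_image_ge:
  assumes B: "B \<in> sets borel" "\<And>C. C \<in> sets borel \<Longrightarrow> C \<subseteq> B \<Longrightarrow> F ` C \<in> sets borel"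
    and cont: "continuous_on B F" and inj: "inj_on F B"
    and dif: "\<And>p. p \<in> B \<Longrightarrow> manifold_differentiable_at F p"
    and t: "t \<ge> 0" "\<And>p. p \<in> B \<Longrightarrow> t \<le> riemannian_jacobian A g F p"
  shows "ennreal t * emeasure (riemannian_volume A g) B \<le> emeasure (riemannian_volume A g) (F ` B)"
proof -
  let ?\<mu> = "emeasure (riemannian_volume A g)"
  \<comment> \<open>Through \<open>prod_decode\<close> a single index runs over all pairs of a piece
    containing the point and a piece containing its image.\<close>
  define Q where "Q i = B \<inter> chart_piece A (fst (prod_decode i)) \<inter> F -` chart_piece A (snd (prod_decode i))" for i
  have QB: "Q i \<subseteq> B" for i by (auto simp: Q_def)
  have Q: "Q i \<in> sets borel" for i
  proof -
    have "F -` chart_piece A (snd (prod_decode i)) \<inter> space (restrict_space borel B) \<in> sets (restrict_space borel B)"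
      by (rule measurable_sets[OF borel_measurable_continuous_on_restrict[OF cont] chart_piece(3)])
    then have "F -` chart_piece A (snd (prod_decode i)) \<inter> B \<in> sets borel"
      using B(1) by (auto simp: sets_restrict_space space_restrict_space)
    moreover have "Q i = chart_piece A (fst (prod_decode i)) \<inter> (F -` chart_piece A (snd (prod_decode i)) \<inter> B)"
      by (auto simp: Q_def)
    ultimately show ?thesis using chart_piece(3) by auto
  qed
  have UQ: "(\<Union>i. Q i) = B"
  proof -
    have "\<exists>i. p \<in> Q i" if p: "p \<in> B" for p
    proof -
      obtain m k where "p \<in> chart_piece A m" "F p \<in> chart_piece A k" using chart_piece(2) by blast
      then show ?thesis using p by (intro exI[of _ "prod_encode (m, k)"]) (simp add: Q_def)
    qed
    then show ?thesis using QB by blast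
  qed
  have dis: "disjoint_family Q"
    unfolding disjoint_family_on_def
  proof (intro ballI impI)
    fix i j :: nat assume "i \<noteq> j"
    then have "fst (prod_decode i) \<noteq> fst (prod_decode j) \<or> snd (prod_decode i) \<noteq> snd (prod_decode j)"
      by (metis prod_decode_inverse prod_eqI)
    then show "Q i \<inter> Q j = {}"
      using chart_piece(1) unfolding Q_def disjoint_family_on_def by blast
  qed
  \<comment> \<open>Injectivity keeps the images disjoint, so their volumes add up to that of the
    whole image.\<close>
  have "disjoint_family (\<lambda>i. F ` Q i)"
    unfolding disjoint_family_on_def
  proof (intro ballI impI)
    fix i j :: nat assume "i \<noteq> j"
    then have "Q i \<inter> Q j = {}" using dis by (simp add: disjoint_family_on_def)
    then show "F ` Q i \<inter> F ` Q j = {}"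
      using inj_on_image_Int[OF inj QB QB, of i j] by simp
  qed
  then have sumF: "(\<Sum>i. ?\<mu> (F ` Q i)) = ?\<mu> (\<Union>i. F ` Q i)"
    using B(2) Q QB by (intro suminf_emeasure) auto
  have le: "ennreal t * ?\<mu> (Q i) \<le> ?\<mu> (F ` Q i)" for i
  proof -
    let ?c = "chart_cover A (fst (prod_decode i))" and ?d = "chart_cover A (snd (prod_decode i))"
    have sub: "Q i \<subseteq> fst ?c" "F ` Q i \<subseteq> fst ?d"
      using chart_piece(4) by (auto simp: Q_def)
    have "ennreal t * chart_volume ?c (Q i) \<le> chart_volume ?d (F ` Q i)"
      by (intro chart_volume_image_ge chart_cover_atlas sub Q B(2) QB t(1) inj_on_subset[OF inj])
         (use QB dif t(2) in auto)
    then show ?thesis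
      using emeasure_volume_chart[OF chart_cover_atlas sub(1) Q] B(2)[OF Q QB]
        emeasure_volume_chart[OF chart_cover_atlas sub(2)] by simp
  qed
  have "ennreal t * ?\<mu> B = ennreal t * (\<Sum>i. ?\<mu> (Q i))"
    using suminf_emeasure[of Q "riemannian_volume A g"] Q dis UQ by (simp add: image_subset_iff)
  also have "\<dots> = (\<Sum>i. ennreal t * ?\<mu> (Q i))" by (rule ennreal_suminf_cmult[symmetric])
  also have "\<dots> \<le> (\<Sum>i. ?\<mu> (F ` Q i))" by (intro suminf_le le) auto
  also have "\<dots> = ?\<mu> (F ` B)" unfolding sumF using UQ by (metis image_UN)
  finally show ?thesis .
qed

text \<open>Volume is locally finite, because the density is bounded on a closed ball inside a chart
  image; compactness leaves finitely many such neighbourhoods.\<close>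

lemma emeasure_volume_compact:
  assumes "compact K"
  shows "emeasure (riemannian_volume A g) K < \<infinity>"
proof -
  let ?\<mu> = "emeasure (riemannian_volume A g)"
  have "\<forall>p. \<exists>N. open N \<and> p \<in> N \<and> ?\<mu> N < \<infinity>"
  proof
    fix p
    obtain c where c: "c \<in> A" "p \<in> fst c" using ex_chart by blast
    let ?u = "\<lambda>y. vol_density g c (chart_inv c y)"
    obtain r where r: "r > 0" "cball (snd c p) r \<subseteq> snd c ` fst c"
      using chartD(2)[OF c(1)] c(2) open_contains_cball by blast
    have cu: "continuous_on (cball (snd c p) r) ?u"
      using continuous_on_vol_density[OF M c(1)] r(2) by (rule continuous_on_subset)
    then have "bounded (?u ` cball (snd c p) r)"
      by (intro compact_imp_bounded compact_continuous_image) auto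
    then obtain b where b: "\<And>y. y \<in> cball (snd c p) r \<Longrightarrow> \<bar>?u y\<bar> \<le> b"
      by (force simp: bounded_iff)
    define N where "N = fst c \<inter> snd c -` ball (snd c p) r"
    have N: "open N" "p \<in> N" "N \<subseteq> fst c"
      using continuous_open_preimage[OF chartD(5)[OF c(1)] chartD(1)[OF c(1)], of "ball (snd c p) r"] c r(1)
      by (auto simp: N_def)
    have "?\<mu> N = chart_volume c N" by (rule emeasure_volume_chart) (use N c in auto)
    also have "\<dots> \<le> (\<integral>\<^sup>+ y. ennreal b * indicator (cball (snd c p) r) y \<partial>lborel)"
      unfolding chart_volume_def
    proof (rule nn_integral_mono)
      fix y :: "real^'n"
      show "ennreal (?u y) * indicator (snd c ` N) y \<le> ennreal b * indicator (cball (snd c p) r) y"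
      proof (cases "y \<in> snd c ` N")
        case True
        then have "y \<in> cball (snd c p) r" by (auto simp: N_def less_imp_le)
        then show ?thesis using b[of y] True by (auto intro!: ennreal_leI)
      qed simp
    qed
    also have "\<dots> = ennreal b * emeasure lborel (cball (snd c p) r)" by (simp add: nn_integral_cmult_indicator)
    also have "\<dots> < \<infinity>" using emeasure_compact_finite[of "cball (snd c p) r"]
      by (auto simp: ennreal_mult_less_top)
    finally show "\<exists>N. open N \<and> p \<in> N \<and> ?\<mu> N < \<infinity>"
      using N(1,2) by (intro exI[of _ N] conjI)
  qed
  from choice[OF this] obtain N where "\<forall>p. open (N p) \<and> p \<in> N p \<and> ?\<mu> (N p) < \<infinity>" ..
  then have N: "open (N p)" "p \<in> N p" "?\<mu> (N p) < \<infinity>" for p by simp_all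
  obtain D where D: "finite D" "D \<subseteq> K" "K \<subseteq> (\<Union>p\<in>D. N p)"
  proof (rule compactE_image[OF assms, of K N])
    show "K \<subseteq> (\<Union>p\<in>K. N p)" using N(2) by blast
  qed (use N(1) in auto)
  have "?\<mu> K \<le> ?\<mu> (\<Union>p\<in>D. N p)"
    using D N by (intro emeasure_mono) auto
  also have "\<dots> \<le> (\<Sum>p\<in>D. ?\<mu> (N p))"
    using D N by (intro emeasure_subadditive_finite) auto
  also have "\<dots> < \<infinity>" using N(3) D(1) by (simp add: less_top[symmetric])
  finally show ?thesis .
qed

end

section \<open>Iterates of the embedding\<close>

locale riemannian_embedding = riemannian +
  fixes U :: "'a set" and f :: "'a \<Rightarrow> 'a"
  assumes compact_U: "compact U" and embedding: "C1_embedding A U f" and into: "f ` U \<subseteq> interior U"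
begin

lemma
  assumes "p \<in> U"
  shows differentiable_f: "manifold_differentiable_at f p"
    and isCont_jacobian_f: "isCont (riemannian_jacobian A g f) p"
    and jacobian_f_pos: "riemannian_jacobian A g f p > 0"
proof -
  obtain V where V: "U \<subseteq> V" "C1_local_diffeo_on A V f"
    using embedding unfolding C1_embedding_def by blast
  then have "p \<in> V" using assms by blast
  note C1_local_diffeo[OF V(2) this]
  then show "manifold_differentiable_at f p" "isCont (riemannian_jacobian A g f) p"
    "riemannian_jacobian A g f p > 0" .
qed

lemma funpow_in_U: "p \<in> U \<Longrightarrow> (f ^^ n) p \<in> U"
  by (induction n) (use into interior_subset in auto)

lemma U_borel: "U \<in> sets borel"
  by (intro borel_closed compact_imp_closed compact_U)

lemma continuous_on_funpow: "continuous_on U (f ^^ n)"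
proof (induction n)
  case (Suc n)
  have "continuous_on U f"
    using differentiable_f by (intro continuous_at_imp_continuous_on) (simp add: manifold_differentiable_at_def)
  then have "continuous_on U (\<lambda>p. f ((f ^^ n) p))"
    by (rule continuous_on_compose2[OF _ Suc]) (use funpow_in_U in auto)
  then show ?case by (simp add: o_def)
qed (simp add: id_def)

lemma inj_on_funpow: "inj_on (f ^^ n) U"
proof (induction n)
  case (Suc n)
  have "inj_on f U" using embedding by (simp add: C1_embedding_def)
  then have "inj_on f ((f ^^ n) ` U)" by (rule inj_on_subset) (use funpow_in_U in auto)
  with Suc show ?case unfolding funpow.simps by (rule comp_inj_on)
qed simp

text \<open>By compactness the iterate is a homeomorphism onto a closed image, so the image of
  \<open>C\<close> is the preimage of \<open>C\<close> under a continuous inverse.\<close>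

lemma funpow_image_borel:
  assumes C: "C \<in> sets borel" "C \<subseteq> U"
  shows "(f ^^ n) ` C \<in> sets borel"
proof -
  let ?F = "f ^^ n" and ?T = "(f ^^ n) ` U"
  obtain h where h: "homeomorphism U ?T ?F h"
    using homeomorphism_compact[OF compact_U continuous_on_funpow refl inj_on_funpow] by blast
  have "?F ` C = {y \<in> ?T. h y \<in> C}"
    using h C(2) unfolding homeomorphism_def by force
  also have "\<dots> = h -` C \<inter> space (restrict_space borel ?T)"
    by (auto simp: space_restrict_space)
  also have "\<dots> \<in> sets (restrict_space borel ?T)"
    by (rule measurable_sets[OF borel_measurable_continuous_on_restrict C(1)])
       (use h in \<open>simp add: homeomorphism_def\<close>)
  finally show ?thesis
    using compact_imp_closed[OF compact_continuous_image[OF continuous_on_funpow compact_U], of n]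
    by (auto simp: sets_restrict_space)
qed

lemma
  assumes p: "p \<in> U"
  shows differentiable_funpow: "manifold_differentiable_at (f ^^ n) p"
    and jacobian_funpow: "riemannian_jacobian A g (f ^^ n) p = (\<Prod>i<n. riemannian_jacobian A g f ((f ^^ i) p))"
  by (rule funpow_jacobian, rule differentiable_f, rule funpow_in_U, rule p)+

text \<open>Turns the growth rate of the Jacobian into a Birkhoff average; positivity along the
  orbit lets the logarithm split the product.\<close>

lemma ln_jacobian_funpow:
  assumes p: "p \<in> U"
  shows "ln (riemannian_jacobian A g (f ^^ n) p) = (\<Sum>i<n. ln (riemannian_jacobian A g f ((f ^^ i) p)))"
  unfolding jacobian_funpow[OF p] using jacobian_f_pos[OF funpow_in_U[OF p]]
  by (intro ln_prod) (simp_all add: dual_order.strict_implies_not_eq)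

lemma jacobian_funpow_pos: "p \<in> U \<Longrightarrow> riemannian_jacobian A g (f ^^ n) p > 0"
  unfolding jacobian_funpow using jacobian_f_pos funpow_in_U by (intro prod_pos) auto

lemma continuous_on_jacobian_f: "continuous_on U (riemannian_jacobian A g f)"
  using isCont_jacobian_f by (intro continuous_at_imp_continuous_on) auto

lemma continuous_on_jacobian_funpow: "continuous_on U (riemannian_jacobian A g (f ^^ n))"
proof -
  have "continuous_on U (\<lambda>p. \<Prod>i<n. riemannian_jacobian A g f ((f ^^ i) p))"
    by (intro continuous_on_prod continuous_on_compose2[OF continuous_on_jacobian_f continuous_on_funpow])
       (use funpow_in_U in auto)
  then show ?thesis by (simp add: jacobian_funpow cong: continuous_on_cong)
qed

section \<open>Exponential growth of the Jacobian and Borel-Cantelli\<close>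

definition expanding :: "nat \<Rightarrow> real \<Rightarrow> 'a set" where
  "expanding n e = {p \<in> U. exp (real n * e) \<le> riemannian_jacobian A g (f ^^ n) p}"

lemma expanding_borel: "expanding n e \<in> sets borel"
proof -
  have "riemannian_jacobian A g (f ^^ n) -` {exp (real n * e)..} \<inter> space (restrict_space borel U) \<in> sets (restrict_space borel U)"
    by (rule measurable_sets[OF borel_measurable_continuous_on_restrict[OF continuous_on_jacobian_funpow]]) simp
  moreover have "riemannian_jacobian A g (f ^^ n) -` {exp (real n * e)..} \<inter> space (restrict_space borel U) = expanding n e"
    by (auto simp: expanding_def space_restrict_space)
  ultimately show ?thesis using U_borel by (auto simp: sets_restrict_space)
qed

lemma emeasure_subset_U_finite: "B \<subseteq> U \<Longrightarrow> emeasure (riemannian_volume A g) B < \<infinity>"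
  using emeasure_mono[of B U "riemannian_volume A g"] emeasure_volume_compact[OF compact_U] U_borel
  by (simp add: le_less_trans)

text \<open>The iterate enlarges the volume of this set by at least the factor
  \<open>exp (real n * e)\<close>, yet its image stays in \<open>U\<close>. The threshold in
  \<open>expanding\<close> serves directly as \<open>t\<close> in
  \<open>emeasure_image_ge\<close>.\<close>

lemma measure_expanding_le:
  "measure (riemannian_volume A g) (expanding n e) \<le> exp (- e) ^ n * measure (riemannian_volume A g) U"
proof -
  let ?M = "riemannian_volume A g" and ?E = "expanding n e"
  have EU: "?E \<subseteq> U" by (auto simp: expanding_def)
  have fin: "emeasure ?M ?E \<noteq> \<infinity>" "emeasure ?M U \<noteq> \<infinity>"
    using emeasure_subset_U_finite[OF EU] emeasure_subset_U_finite[of U] by auto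
  have "ennreal (exp (real n * e)) * emeasure ?M ?E \<le> emeasure ?M ((f ^^ n) ` ?E)"
  proof (rule emeasure_image_ge)
    show "(f ^^ n) ` C \<in> sets borel" if "C \<in> sets borel" "C \<subseteq> ?E" for C
      using that EU by (intro funpow_image_borel) auto
    show "continuous_on ?E (f ^^ n)" using continuous_on_funpow EU by (rule continuous_on_subset)
    show "inj_on (f ^^ n) ?E" using inj_on_funpow EU by (rule inj_on_subset)
    show "manifold_differentiable_at (f ^^ n) p" if "p \<in> ?E" for p
      using that EU by (intro differentiable_funpow) auto
    show "?E \<in> sets borel" by (rule expanding_borel)
  qed (auto simp: expanding_def)
  also have "\<dots> \<le> emeasure ?M U"
    using EU funpow_in_U U_borel by (intro emeasure_mono) auto
  \<comment> \<open>Both volumes are finite, so the inequality passes to the reals, where the factor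
    can be divided out.\<close>
  finally have "exp (real n * e) * measure ?M ?E \<le> measure ?M U"
    using fin by (simp add: emeasure_eq_ennreal_measure ennreal_mult[symmetric])
  then have "exp (- (real n * e)) * (exp (real n * e) * measure ?M ?E) \<le> exp (- (real n * e)) * measure ?M U"
    by (intro mult_left_mono) auto
  moreover have "exp (- (real n * e)) = exp (- e) ^ n" by (simp add: exp_of_nat_mult[symmetric])
  ultimately show ?thesis by (simp add: mult.assoc[symmetric] exp_minus)
qed

text \<open>For \<open>e > 0\<close> the bounds form a geometric series with ratio
  \<open>exp (- e) < 1\<close>.\<close>

lemma AE_eventually_not_expanding:
  assumes "e > 0"
  shows "AE x in riemannian_volume A g. eventually (\<lambda>n. x \<notin> expanding n e) sequentially"
proof -
  let ?M = "riemannian_volume A g"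
  have "summable (\<lambda>n. exp (- e) ^ n * measure ?M U)"
    using assms by (intro summable_mult2 summable_geometric) simp
  then have "summable (\<lambda>n. measure ?M (expanding n e))"
    by (rule summable_comparison_test'[where N = 0]) (simp add: measure_expanding_le)
  moreover have "emeasure ?M (expanding n e) < \<infinity>" for n
    by (rule emeasure_subset_U_finite) (auto simp: expanding_def)
  ultimately have "AE x in ?M. eventually (\<lambda>n. x \<in> space ?M - expanding n e) sequentially"
    by (intro borel_cantelli_AE1) (auto simp: expanding_borel)
  then show ?thesis by simp
qed

text \<open>One null set has to serve every \<open>e\<close>; the thresholds
  \<open>inverse (Suc k)\<close> are countably many and arbitrarily small.\<close>

lemma ex_full_volume_set:
  "\<exists>N\<in>null_sets (riemannian_volume A g). \<forall>x\<in>U - N. \<forall>e>0.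
    eventually (\<lambda>n. 1 / real n * ln (riemannian_jacobian A g (f ^^ n) x) < e) sequentially"
proof -
  let ?M = "riemannian_volume A g"
  have "AE x in ?M. \<forall>k. eventually (\<lambda>n. x \<notin> expanding n (inverse (Suc k))) sequentially"
    unfolding AE_all_countable by (intro allI AE_eventually_not_expanding) simp
  then obtain N where N: "N \<in> null_sets ?M"
    "\<And>x k. x \<notin> N \<Longrightarrow> eventually (\<lambda>n. x \<notin> expanding n (inverse (Suc k))) sequentially"
    by (rule AE_E3) auto
  have lim: "eventually (\<lambda>n. 1 / real n * ln (riemannian_jacobian A g (f ^^ n) x) < e) sequentially"
    if x: "x \<in> U - N" and e: "e > 0" for x e
  proof -
    obtain k where k: "inverse (Suc k) < e" using reals_Archimedean[OF e] by blast
    have "eventually (\<lambda>n. x \<notin> expanding n (inverse (Suc k))) sequentially" using N(2) x by simp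
    with eventually_gt_at_top[of 0] show ?thesis
    proof eventually_elim
      case (elim n)
      then have "riemannian_jacobian A g (f ^^ n) x < exp (real n * inverse (Suc k))"
        using x by (auto simp: expanding_def)
      then have "ln (riemannian_jacobian A g (f ^^ n) x) < real n * inverse (Suc k)"
        using x jacobian_funpow_pos[of x n] by (metis DiffD1 exp_less_cancel_iff exp_ln)
      then have "1 / real n * ln (riemannian_jacobian A g (f ^^ n) x) < inverse (Suc k)"
        using elim by (simp add: field_simps)
      then show ?case using k by linarith
    qed
  qed
  show ?thesis by (intro bexI[OF _ N(1)] ballI allI impI lim)
qed

section \<open>Orbit averages and their weak* accumulation points\<close>

lemma orbit_average_integral:
  fixes \<phi> :: "'a \<Rightarrow> real"
  assumes x: "x \<in> U" and \<phi>: "continuous_on U \<phi>" and n: "n > 0"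
  shows "(\<integral>y. \<phi> y \<partial>orbit_average U f x n) = 1 / real n * (\<Sum>i<n. \<phi> ((f ^^ i) x))"
proof -
  have "(\<lambda>i. (f ^^ i) x) \<in> uniform_count_measure {..<n} \<rightarrow>\<^sub>M restrict_space borel U"
    using funpow_in_U[OF x]
    by (simp add: measurable_cong_sets[OF sets_uniform_count_measure_count_space refl] space_restrict_space)
  then have "(\<integral>y. \<phi> y \<partial>orbit_average U f x n) = (\<integral>i. \<phi> ((f ^^ i) x) \<partial>uniform_count_measure {..<n})"
    unfolding orbit_average_def
    by (intro integral_distr borel_measurable_continuous_on_restrict \<phi>)
  then show ?thesis by (simp add: integral_uniform_count_measure)
qed

text \<open>The measure has the compact set \<open>U\<close> as its whole space, and
  \<open>\<phi>\<close> is bounded there.\<close>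

lemma prob_measure_integrable:
  fixes \<phi> :: "'a \<Rightarrow> real"
  assumes \<nu>: "\<nu> \<in> prob_measures_on U" and \<phi>: "continuous_on U \<phi>"
  shows "integrable \<nu> \<phi>"
proof -
  have s: "sets \<nu> = sets (restrict_space borel U)" "emeasure \<nu> U = 1"
    using \<nu> by (auto simp: prob_measures_on_def)
  have sp: "space \<nu> = U" using sets_eq_imp_space_eq[OF s(1)] by (simp add: space_restrict_space)
  interpret finite_measure \<nu> by standard (simp add: sp s)
  have "bounded (\<phi> ` U)" by (intro compact_imp_bounded compact_continuous_image \<phi> compact_U)
  then obtain b where "\<And>y. y \<in> U \<Longrightarrow> norm (\<phi> y) \<le> b" by (auto simp: bounded_iff)
  moreover have "\<phi> \<in> borel_measurable \<nu>"
    using borel_measurable_continuous_on_restrict[OF \<phi>] by (simp add: measurable_cong_sets[OF s(1) refl])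
  ultimately show ?thesis
    by (intro integrable_const_bound[of _ b]) (auto simp: sp)
qed

text \<open>The measures whose integral of \<open>\<phi>\<close> exceeds a threshold form a subbasic
  weak* open set. If it contained \<open>\<nu>\<close>, infinitely many orbit averages would lie in
  it, against \<open>lim\<close>.\<close>

lemma empirical_integral_le:
  fixes \<phi> :: "'a \<Rightarrow> real"
  assumes \<nu>: "empirical_measure U f x \<nu>" and x: "x \<in> U" and \<phi>: "continuous_on U \<phi>"
    and lim: "\<And>e. e > 0 \<Longrightarrow> eventually (\<lambda>n. 1 / real n * (\<Sum>i<n. \<phi> ((f ^^ i) x)) < e) sequentially"
  shows "(\<integral>y. \<phi> y \<partial>\<nu>) \<le> 0"
proof (rule ccontr)
  assume pos: "\<not> (\<integral>y. \<phi> y \<partial>\<nu>) \<le> 0"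
  \<comment> \<open>Any number strictly between 0 and the integral would serve as threshold.\<close>
  define e where "e = (\<integral>y. \<phi> y \<partial>\<nu>) / 2"
  have e: "0 < e" "e < (\<integral>y. \<phi> y \<partial>\<nu>)" using pos by (simp_all add: e_def)
  define W where "W = {\<mu> \<in> prob_measures_on U. (\<integral>y. \<phi> y \<partial>\<mu>) \<in> {e<..}}"
  have "openin (weak_star_topology U) W"
    unfolding weak_star_topology_def W_def
    by (rule topology_generated_by_Basis, rule CollectI, intro exI conjI) (rule refl \<phi> open_greaterThan)+
  moreover have "\<nu> \<in> W" using \<nu> e by (simp add: W_def empirical_measure_def)
  ultimately have "\<exists>\<^sub>F n in sequentially. orbit_average U f x n \<in> W"
    using \<nu> by (simp add: empirical_measure_def)
  moreover have "eventually (\<lambda>n. orbit_average U f x n \<notin> W) sequentially"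
    using lim[OF e(1)] eventually_gt_at_top[of 0]
    by eventually_elim (auto simp: W_def orbit_average_integral[OF x \<phi>])
  ultimately show False by (simp add: frequently_def)
qed

end

theorem theorem3p1:
  fixes A :: "('a::{second_countable_topology,t2_space}, 'n::finite) chart set"
    and g :: "('a, 'n) metric"
    and U :: "'a set"
    and f :: "'a \<Rightarrow> 'a"
  assumes "riemannian_manifold A g"
    and "compact U"
    and "C1_embedding A U f"
    and "f ` U \<subseteq> interior U"
  shows "\<exists>\<Gamma>\<subseteq>U. U - \<Gamma> \<in> null_sets (riemannian_volume A g) \<and>
    (\<forall>x\<in>\<Gamma>.
       limsup (\<lambda>n. ereal (1 / real n * ln (riemannian_jacobian A g (f ^^ n) x))) \<le> 0 \<and>
       (\<forall>\<nu>. empirical_measure U f x \<nu> \<longrightarrow>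
          integrable \<nu> (\<lambda>y. ln (riemannian_jacobian A g f y)) \<and>
          (\<integral>y. ln (riemannian_jacobian A g f y) \<partial>\<nu>) \<le> 0))"
proof -
  interpret riemannian_embedding A g U f by standard (use assms in auto)
  from ex_full_volume_set obtain N where N: "N \<in> null_sets (riemannian_volume A g)"
    and *: "\<forall>x\<in>U - N. \<forall>e>0.
      eventually (\<lambda>n. 1 / real n * ln (riemannian_jacobian A g (f ^^ n) x) < e) sequentially" ..
  note lim = *[rule_format]
  \<comment> \<open>The logarithm is continuous here because the Jacobian is positive on all of
    \<open>U\<close>.\<close>
  have cont: "continuous_on U (\<lambda>y. ln (riemannian_jacobian A g f y))"
    by (intro continuous_on_ln continuous_on_jacobian_f ballI dual_order.strict_implies_not_eq jacobian_f_pos)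
  show ?thesis
  \<comment> \<open>The set \<Gamma> is \<open>U - N\<close>, with \<open>N\<close> the exceptional
    null set.\<close>
  proof (intro exI[of _ "U - N"] conjI ballI allI impI)
    have "U - (U - N) = U \<inter> N" by blast
    then show "U - (U - N) \<in> null_sets (riemannian_volume A g)"
      using null_set_Int1[OF N, of U] U_borel by simp
  next
    fix x assume x: "x \<in> U - N"
    show "limsup (\<lambda>n. ereal (1 / real n * ln (riemannian_jacobian A g (f ^^ n) x))) \<le> 0"
    proof (rule ereal_le_epsilon2)
      fix e :: real assume "e > 0"
      from lim[OF x this]
      have "eventually (\<lambda>n. ereal (1 / real n * ln (riemannian_jacobian A g (f ^^ n) x)) \<le> 0 + ereal e) sequentially"
        by eventually_elim simp
      then show "limsup (\<lambda>n. ereal (1 / real n * ln (riemannian_jacobian A g (f ^^ n) x))) \<le> 0 + ereal e"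
        by (rule Limsup_bounded)
    qed
    fix \<nu> assume \<nu>: "empirical_measure U f x \<nu>"
    \<comment> \<open>Integrability rules out that the integral is merely the default value 0 of a
      non-integrable function, which would satisfy the bound trivially.\<close>
    then show "integrable \<nu> (\<lambda>y. ln (riemannian_jacobian A g f y))"
      by (intro prob_measure_integrable cont) (simp add: empirical_measure_def)
    show "(\<integral>y. ln (riemannian_jacobian A g f y) \<partial>\<nu>) \<le> 0"
    proof (rule empirical_integral_le[OF \<nu> _ cont])
      show xU: "x \<in> U" using x by simp
      fix e :: real assume "e > 0"
      \<comment> \<open>The orbit averages of the logarithm are the growth rates bounded by
        \<open>lim\<close>.\<close>
      from lim[OF x this] show "eventually (\<lambda>n. 1 / real n *
          (\<Sum>i<n. ln (riemannian_jacobian A g f ((f ^^ i) x))) < e) sequentially"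
        by (simp only: ln_jacobian_funpow[OF xU])
    qed
  qed auto
qed

end
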